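(* Let $K$ be a Noetherian ring, let $G\leq\mathbb{R}$ be an additive subgroup, and let $\Lambda_K(G)$ be the Novikov ring of $G$ over $K$. Let $A\in M_{n\times m}(\Lambda_K(G))$ and $\vec{t}=(t_1,\ldots,t_n)\in\mathbb{R}^n$. For $(a_1,\ldots,a_n)\in\Lambda_K(G)^n$ define $$\bar\nu_{\vec{t}}(a_1,\ldots,a_n)=\min_{1\leq i\leq n}(\nu(a_i)-t_i).$$ Then there is $\gamma\in\mathbb{R}$, depending only on $\vec{t}$ and $A$, with the following property. If $w\in\Lambda_K(G)^n$ then there is $x_0\in\Lambda_K(G)^m$ such that $$\bar\nu(x_0)\geq\bar\nu_{\vec{t}}(w)-\gamma\quad\text{and}\quad \bar\nu_{\vec{t}}(w-Ax_0)=\sup_{x\in\Lambda_K(G)^m}\bar\nu_{\vec{t}}(w-Ax).$$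
   Context: Rings are commutative with unit. For an additive subgroup $G\le\mathbb{R}$ and a ring $K$, $$\Lambda_K(G)=\Big\{\sum_{g\in G}c_gT^g\;\Big|\;c_g\in K,\ (\forall C>0)(\#\{g\mid c_g\neq 0,\ g<C\}<\infty)\Big\},$$ with the usual addition and multiplication of formal series ($T^gT^h=T^{g+h}$). For $a=\sum c_gT^g\in\Lambda_K(G)$, $\nu(a)=\min\{g\mid c_g\neq0\}$ if $a\ne 0$, and $\nu(0)=\infty$. For $(a_1,\ldots,a_m)\in\Lambda_K(G)^m$, $\bar\nu(a_1,\ldots,a_m)=\min_{1\le i\le m}\nu(a_i)\in\mathbb{R}\cup\{\infty\}$. Suprema are taken in $\mathbb{R}\cup\{\infty\}$, with $\infty - t=\infty$ for $t\in\mathbb{R}$. *)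

theory Defs
  imports "HOL-Algebra.Algebra" "HOL-Library.Extended_Real"
begin

definition real_add_group :: "real monoid"
  where "real_add_group = \<lparr>carrier = UNIV, monoid.mult = (+), one = 0\<rparr>"

text \<open>A formal series is represented by its coefficient function on all of the reals, which is
  required to vanish off \<open>G\<close>. For members of the carrier, the index set in the product is finite.\<close>

definition novikov_ring :: "('a, 'b) ring_scheme \<Rightarrow> real set \<Rightarrow> (real \<Rightarrow> 'a) ring"
  where "novikov_ring K G =
   \<lparr>carrier = {c. (\<forall>g. c g \<in> carrier K) \<and> (\<forall>g. g \<notin> G \<longrightarrow> c g = \<zero>\<^bsub>K\<^esub>)
                 \<and> (\<forall>C>0. finite {g. c g \<noteq> \<zero>\<^bsub>K\<^esub> \<and> g < C})},
    monoid.mult = (\<lambda>a b k. \<Oplus>\<^bsub>K\<^esub>g\<in>{g. a g \<noteq> \<zero>\<^bsub>K\<^esub> \<and> b (k - g) \<noteq> \<zero>\<^bsub>K\<^esub>}. a g \<otimes>\<^bsub>K\<^esub> b (k - g)),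
    one = (\<lambda>g. if g = 0 then \<one>\<^bsub>K\<^esub> else \<zero>\<^bsub>K\<^esub>),
    ring.zero = (\<lambda>g. \<zero>\<^bsub>K\<^esub>),
    ring.add = (\<lambda>a b g. a g \<oplus>\<^bsub>K\<^esub> b g)\<rparr>"

text \<open>The support of a nonzero element of the Novikov ring has a least element, so
  \<open>LEAST\<close> is a minimum there.\<close>

definition nu :: "('a, 'b) ring_scheme \<Rightarrow> (real \<Rightarrow> 'a) \<Rightarrow> ereal"
  where "nu K a = (if \<forall>g. a g = \<zero>\<^bsub>K\<^esub> then \<infinity> else ereal (LEAST g. a g \<noteq> \<zero>\<^bsub>K\<^esub>))"

text \<open>Vectors are indexed by \<open>{..<n}\<close>, and \<open>n\<close> by \<open>m\<close> matrices by \<open>{..<n}\<close> and \<open>{..<m}\<close>.\<close>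

definition novikov_vecs :: "('a, 'b) ring_scheme \<Rightarrow> real set \<Rightarrow> nat \<Rightarrow> (nat \<Rightarrow> real \<Rightarrow> 'a) set"
  where "novikov_vecs K G n = {..<n} \<rightarrow>\<^sub>E carrier (novikov_ring K G)"

definition novikov_mult_vec ::
  "('a, 'b) ring_scheme \<Rightarrow> real set \<Rightarrow> nat \<Rightarrow> nat \<Rightarrow>
    (nat \<Rightarrow> nat \<Rightarrow> real \<Rightarrow> 'a) \<Rightarrow> (nat \<Rightarrow> real \<Rightarrow> 'a) \<Rightarrow> nat \<Rightarrow> real \<Rightarrow> 'a"
  where "novikov_mult_vec K G n m A x =
    (\<lambda>i\<in>{..<n}. \<Oplus>\<^bsub>novikov_ring K G\<^esub>j\<in>{..<m}. A i j \<otimes>\<^bsub>novikov_ring K G\<^esub> x j)"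

definition novikov_diff_vec ::
  "('a, 'b) ring_scheme \<Rightarrow> real set \<Rightarrow> nat \<Rightarrow>
    (nat \<Rightarrow> real \<Rightarrow> 'a) \<Rightarrow> (nat \<Rightarrow> real \<Rightarrow> 'a) \<Rightarrow> nat \<Rightarrow> real \<Rightarrow> 'a"
  where "novikov_diff_vec K G n u v = (\<lambda>i\<in>{..<n}. u i \<ominus>\<^bsub>novikov_ring K G\<^esub> v i)"

text \<open>The infimum over a finite nonempty index set is a minimum; over the empty one it is \<open>\<infinity>\<close>.\<close>

definition nu_bar :: "('a, 'b) ring_scheme \<Rightarrow> nat \<Rightarrow> (nat \<Rightarrow> real \<Rightarrow> 'a) \<Rightarrow> ereal"
  where "nu_bar K m a = (INF i\<in>{..<m}. nu K (a i))"

definition nu_bar_shift ::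
  "('a, 'b) ring_scheme \<Rightarrow> nat \<Rightarrow> (nat \<Rightarrow> real) \<Rightarrow> (nat \<Rightarrow> real \<Rightarrow> 'a) \<Rightarrow> ereal"
  where "nu_bar_shift K n t a = (INF i\<in>{..<n}. nu K (a i) - ereal (t i))"

end

theory Submission
  imports Defs
begin

text \<open>
  The argument is a Groebner basis division with respect to the exponent \<open>g - t i\<close> of the monomial
  \<open>T\<^sup>g\<close> in position \<open>i\<close>, ties between positions being broken by the index \<open>i\<close>. It is a division
  by power series, so that it cancels terms of smallest exponent and may take infinitely many steps.
  Two points need an argument: why finitely much data suffices to cancel the leading
  term of every element of the column space of \<open>A\<close>, and why infinitely many cancellations converge.

  Since \<open>G\<close> is a group, every \<open>T\<^sup>h\<close> with \<open>h \<in> G\<close> is a unit, so a leading term in position \<open>i\<close> may be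
  moved to exponent \<open>0\<close>. The leading coefficients that occur there form an ideal of \<open>K\<close>. Stratify it
  by the data to be bounded: \<open>lead i \<gamma> P\<close> collects the leading coefficients of the \<open>A z\<close> for
  which \<open>z\<close> has valuation at least \<open>\<gamma>\<close> and the support of \<open>A z\<close>, measured from its leading term,
  lies in the locally finite set \<open>P \<subseteq> [0, \<infinity>)\<close>. These ideals are directed under enlarging \<open>P\<close> and lowering \<open>\<gamma>\<close>,
  so, \<open>K\<close> being Noetherian, a single one of them contains all the others (\<open>lead_stabilises\<close>). Treating the
  finitely many positions in turn yields one \<open>\<gamma>\<close> and one \<open>P\<close> such that the part of exponent \<open>s\<close> of any
  \<open>A y\<close> with no smaller exponents is cancelled by some \<open>A z\<close>, where \<open>z\<close> has valuation at least
  \<open>s + \<gamma>\<close> and \<open>A z\<close> is supported in \<open>s + P\<close> (\<open>leading_part_cancellable\<close>).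

  Now suppose that no \<open>x\<close> of valuation at least \<open>s\<^sub>0 + \<gamma>\<close>, with \<open>s\<^sub>0\<close> the valuation of \<open>w\<close>, is optimal.
  If the residual \<open>w - A x\<close> has valuation \<open>s\<close> and some \<open>w - A y\<close> has a larger one, then the part of
  \<open>w - A x\<close> of exponent \<open>s\<close> is that of \<open>A (y - x)\<close>, so it can be cancelled at the cost above.
  Repeating this, all residuals are supported in the set obtained from the support of \<open>w\<close> by
  repeatedly adding elements of \<open>P\<close>. This set is locally finite (\<open>lfin_translates\<close>): below a given bound only
  boundedly many nonzero elements of \<open>P\<close> can have been added. Hence the strictly increasing
  valuations of the residuals tend to infinity, the corrections to \<open>x\<close> converge, and the limit solves
  \<open>w = A x\<close>. It is therefore optimal after all (\<open>optimal_approximation_exists\<close>).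
\<close>

section \<open>Locally finite sets of exponents\<close>

definition lfin :: "real set \<Rightarrow> bool"
  where "lfin S \<longleftrightarrow> (\<forall>C. finite (S \<inter> {..<C}))"

lemma lfin_subset: "lfin T \<Longrightarrow> S \<subseteq> T \<Longrightarrow> lfin S"
  unfolding lfin_def by (meson Int_mono finite_subset order_refl)

lemma lfin_Un: "lfin S \<Longrightarrow> lfin T \<Longrightarrow> lfin (S \<union> T)"
  by (simp add: lfin_def Int_Un_distrib2)

lemma lfin_UN: "finite I \<Longrightarrow> (\<And>i. i \<in> I \<Longrightarrow> lfin (S i)) \<Longrightarrow> lfin (\<Union>i\<in>I. S i)"
  by (induction I rule: finite_induct) (auto simp: lfin_Un, simp add: lfin_def)

lemma lfin_shift:
  assumes "lfin S"
  shows "lfin ((\<lambda>s. s + a) ` S)"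
  unfolding lfin_def
proof
  fix C
  have "(\<lambda>s. s + a) ` S \<inter> {..<C} \<subseteq> (\<lambda>s. s + a) ` (S \<inter> {..<C - a})" by auto
  then show "finite ((\<lambda>s. s + a) ` S \<inter> {..<C})"
    using assms by (meson finite_imageI finite_subset lfin_def)
qed

lemma lfin_min:
  assumes "lfin S" "S \<noteq> {}"
  obtains s where "s \<in> S" "S \<subseteq> {s..}"
proof -
  obtain b where b: "b \<in> S" using assms(2) by blast
  let ?F = "S \<inter> {..<b + 1}"
  have F: "finite ?F" "b \<in> ?F" using assms(1) b by (auto simp: lfin_def)
  then have M: "Min ?F \<in> ?F" by (intro Min_in) auto
  have "Min ?F \<le> s" if "s \<in> S" for s
  proof (cases "s < b + 1")
    case True
    then show ?thesis using F that by (intro Min_le) auto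
  next
    case False
    have "Min ?F \<le> b" using F by (intro Min_le) auto
    then show ?thesis using False by linarith
  qed
  then show ?thesis using that M by blast
qed

lemma lfin_lower_bound:
  assumes "lfin S"
  obtains a where "S \<subseteq> {a..}"
proof (cases "S = {}")
  case False
  then show ?thesis using that lfin_min[OF assms] by blast
qed (use that in blast)

text \<open>The sums of an element of \<open>W\<close> and finitely many elements of \<open>P\<close>: these are the exponents that can
  appear when a vector with exponents in \<open>W\<close> is reduced by vectors whose exponents, relative to the
  leading one, lie in \<open>P\<close>.\<close>

inductive_set translates :: "real set \<Rightarrow> real set \<Rightarrow> real set" for W P where
  base: "w \<in> W \<Longrightarrow> w \<in> translates W P"
| step: "e \<in> translates W P \<Longrightarrow> p \<in> P \<Longrightarrow> e + p \<in> translates W P"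

lemma translates_lower_bound:
  assumes "e \<in> translates W P" "W \<subseteq> {a..}" "P \<subseteq> {0..}"
  shows "a \<le> e"
  using assms by induction force+

text \<open>Summands equal to \<open>0\<close> can be dropped, so the last one may be taken positive. This makes the
  recursion in \<open>lfin_translates\<close> descend.\<close>

lemma translates_last_step:
  assumes "e \<in> translates W P" "P \<subseteq> {0..}"
  shows "e \<in> W \<or> (\<exists>e'\<in>translates W P. \<exists>p\<in>P. 0 < p \<and> e = e' + p)"
  using assms(1)
proof induction
  case (step e p)
  show ?case
  proof (cases "p = 0")
    case False
    then have "0 < p" using step.hyps(2) assms(2) by force
    then show ?thesis using step.hyps by blast
  qed (use step.IH in simp)
qed simp

text \<open>The positive elements of \<open>P\<close> are bounded below by some \<open>\<epsilon> > 0\<close>. Hence the elements of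
  the set below \<open>a + (k + 1) \<epsilon>\<close> arise from those below \<open>a + k \<epsilon>\<close> by one addition, and finiteness
  follows by induction on \<open>k\<close>.\<close>

lemma lfin_translates:
  assumes "lfin W" "lfin P" "P \<subseteq> {0..}"
  shows "lfin (translates W P)"
proof -
  obtain a where a: "W \<subseteq> {a..}" using lfin_lower_bound[OF assms(1)] .
  have "lfin (P \<inter> {0<..})" using assms(2) by (rule lfin_subset) auto
  then obtain \<epsilon> where \<epsilon>: "\<epsilon> > 0" "\<And>p. p \<in> P \<Longrightarrow> 0 < p \<Longrightarrow> \<epsilon> \<le> p"
  proof (cases "P \<inter> {0<..} = {}")
    case True
    show ?thesis using True that[of 1] by auto
  next
    case False
    with \<open>lfin (P \<inter> {0<..})\<close> obtain s where "s \<in> P \<inter> {0<..}" "P \<inter> {0<..} \<subseteq> {s..}"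
      using lfin_min by blast
    then show ?thesis using that[of s] by auto
  qed
  have fin: "finite (translates W P \<inter> {..<a + real k * \<epsilon>})" for k
  proof (induction k)
    case 0
    have "translates W P \<inter> {..<a} = {}"
      using translates_lower_bound[OF _ a assms(3)] by force
    then show ?case by simp
  next
    case (Suc k)
    let ?C = "a + real (Suc k) * \<epsilon>"
    let ?E = "translates W P \<inter> {..<a + real k * \<epsilon>}"
    have "translates W P \<inter> {..<?C} \<subseteq>
      W \<inter> {..<?C} \<union> (\<lambda>(e, p). e + p) ` (?E \<times> (P \<inter> {..<?C - a}))"
    proof
      fix e assume e: "e \<in> translates W P \<inter> {..<?C}"
      consider "e \<in> W"
        | e' p where "e' \<in> translates W P" "p \<in> P" "0 < p" "e = e' + p"
        using translates_last_step[of e W P] e assms(3) by blast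
      then show "e \<in> W \<inter> {..<?C} \<union> (\<lambda>(e, p). e + p) ` (?E \<times> (P \<inter> {..<?C - a}))"
      proof cases
        case 1
        then show ?thesis using e by simp
      next
        case 2
        have "\<epsilon> \<le> p" using \<epsilon>(2) 2 by blast
        moreover have "a \<le> e'" using translates_lower_bound[OF 2(1) a assms(3)] .
        ultimately have "(e', p) \<in> ?E \<times> (P \<inter> {..<?C - a})"
          using e 2 by (auto simp: algebra_simps)
        then show ?thesis using 2(4) by force
      qed
    qed
    moreover have "finite (W \<inter> {..<?C} \<union> (\<lambda>(e, p). e + p) ` (?E \<times> (P \<inter> {..<?C - a})))"
      using Suc assms(1,2) by (auto simp: lfin_def)
    ultimately show ?case by (rule finite_subset)
  qed
  show ?thesis
    unfolding lfin_def
  proof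
    fix C
    obtain k where "(C - a) / \<epsilon> < real k" using reals_Archimedean2 by blast
    then have "C \<le> a + real k * \<epsilon>" using \<epsilon>(1) by (simp add: field_simps)
    then have "translates W P \<inter> {..<C} \<subseteq> translates W P \<inter> {..<a + real k * \<epsilon>}" by auto
    then show "finite (translates W P \<inter> {..<C})" using fin finite_subset by blast
  qed
qed

lemma strict_mono_in_lfin_unbounded:
  assumes "lfin E" "strict_mono s" "\<And>k::nat. s k \<in> E"
  obtains k where "C \<le> s k"
proof (cases "\<exists>k. C \<le> s k")
  case False
  \<comment> \<open>Otherwise \<open>s\<close> embeds the natural numbers into a finite set.\<close>
  then have "range s \<subseteq> E \<inter> {..<C}" using assms(3) by (auto simp: not_le)
  then have "finite (range s)" using assms(1) unfolding lfin_def by (meson finite_subset)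
  moreover have "inj s" using assms(2) by (rule strict_mono_imp_inj_on)
  ultimately show ?thesis using finite_imageD infinite_UNIV_nat by blast
qed (use that in blast)

section \<open>Directed families of ideals in a Noetherian ring\<close>

text \<open>The union of the family is an ideal, hence generated by finitely many elements; by directedness
  these lie in a single member, which is then the whole union.\<close>

lemma (in noetherian_ring) directed_family_of_ideals_has_greatest:
  assumes "\<J> \<noteq> {}" "\<And>I. I \<in> \<J> \<Longrightarrow> ideal I R"
    and "\<And>I J. I \<in> \<J> \<Longrightarrow> J \<in> \<J> \<Longrightarrow> \<exists>H\<in>\<J>. I \<subseteq> H \<and> J \<subseteq> H"
  obtains I where "I \<in> \<J>" "\<And>J. J \<in> \<J> \<Longrightarrow> J \<subseteq> I"
proof -
  have dir: "\<exists>I\<in>\<J>. F \<subseteq> I" if "finite F" "F \<subseteq> \<Union>\<J>" for F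
    using that
  proof induction
    case empty
    then show ?case using assms(1) by auto
  next
    case (insert x F)
    then obtain I J where "I \<in> \<J>" "F \<subseteq> I" "J \<in> \<J>" "x \<in> J" by auto
    then show ?case using assms(3)[of I J] by blast
  qed
  have "ideal (\<Union>\<J>) R"
  proof (rule idealI)
    show "subgroup (\<Union>\<J>) (add_monoid R)"
    proof (rule add.subgroupI)
      show "\<Union>\<J> \<subseteq> carrier R"
        using assms(2) ideal.Icarr by fastforce
      obtain I where "I \<in> \<J>" using assms(1) by blast
      then show "\<Union>\<J> \<noteq> {}"
        using additive_subgroup.zero_closed[OF ideal.axioms(1)[OF assms(2)]] by blast
    next
      fix a assume "a \<in> \<Union>\<J>"
      then show "\<ominus> a \<in> \<Union>\<J>"
        using additive_subgroup.a_inv_closed[OF ideal.axioms(1)[OF assms(2)]] by blast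
    next
      fix a b assume "a \<in> \<Union>\<J>" "b \<in> \<Union>\<J>"
      then obtain I where "I \<in> \<J>" "a \<in> I" "b \<in> I" using dir[of "{a, b}"] by auto
      then show "a \<oplus> b \<in> \<Union>\<J>"
        using additive_subgroup.a_closed[OF ideal.axioms(1)[OF assms(2)]] by blast
    qed
  next
    fix a x assume "a \<in> \<Union>\<J>" and x: "x \<in> carrier R"
    then obtain I where I: "I \<in> \<J>" "a \<in> I" by blast
    then interpret ideal I R using assms(2) by blast
    show "x \<otimes> a \<in> \<Union>\<J>" "a \<otimes> x \<in> \<Union>\<J>" using I I_l_closed I_r_closed x by blast+
  qed (rule ring_axioms)
  from finetely_gen[OF this] obtain F where F: "F \<subseteq> carrier R" "finite F" "\<Union>\<J> = Idl F"
    by auto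
  obtain I where I: "I \<in> \<J>" "F \<subseteq> I"
    using dir[OF F(2)] genideal_self[OF F(1)] unfolding F(3) by blast
  then have "\<Union>\<J> \<subseteq> I" using F(3) genideal_minimal[OF assms(2)] by simp
  then show ?thesis using that I(1) by blast
qed

section \<open>Coefficientwise arithmetic in the Novikov ring\<close>

lemma (in abelian_group) diff_diff_cancel:
  assumes "w \<in> carrier G" "a \<in> carrier G" "b \<in> carrier G"
  shows "(w \<ominus> a) \<ominus> (w \<ominus> b) = b \<ominus> a"
proof -
  have "(w \<ominus> a) \<ominus> (w \<ominus> b) = w \<oplus> (\<ominus> w \<oplus> (b \<oplus> \<ominus> a))"
    using assms by (simp add: a_minus_def minus_add a_ac)
  then show ?thesis using assms by (simp add: a_minus_def r_neg1 r_neg2)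
qed

lemma (in abelian_group) diff_add:
  assumes "w \<in> carrier G" "a \<in> carrier G" "c \<in> carrier G"
  shows "w \<ominus> (a \<oplus> c) = (w \<ominus> a) \<ominus> c"
  using assms by (simp add: a_minus_def minus_add a_assoc)

lemma (in abelian_group) diff_add_telescope:
  assumes "w \<in> carrier G" "a \<in> carrier G" "b \<in> carrier G" "c \<in> carrier G"
  shows "w \<ominus> (a \<oplus> c) = (w \<ominus> b) \<oplus> ((b \<ominus> a) \<ominus> c)"
proof -
  have "(w \<ominus> b) \<oplus> ((b \<ominus> a) \<ominus> c) = w \<oplus> (\<ominus> b \<oplus> (b \<oplus> (\<ominus> a \<oplus> \<ominus> c)))"
    using assms by (simp add: a_minus_def a_assoc)
  then show ?thesis using assms by (simp add: a_minus_def minus_add r_neg1 r_neg2)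
qed

locale novikov = cring K for K :: "('a, 'b) ring_scheme" (structure) +
  fixes G :: "real set"
  assumes subgroup_G: "subgroup G real_add_group"
begin

abbreviation N where "N \<equiv> novikov_ring K G"

lemma G_add: "g \<in> G \<Longrightarrow> h \<in> G \<Longrightarrow> g + h \<in> G"
  using subgroup.m_closed[OF subgroup_G] by (simp add: real_add_group_def)

lemma G_zero: "0 \<in> G"
  using subgroup.one_closed[OF subgroup_G] by (simp add: real_add_group_def)

lemma G_minus:
  assumes "g \<in> G"
  shows "- g \<in> G"
proof -
  interpret A: group real_add_group
    by (rule groupI) (auto simp: real_add_group_def intro: exI[of _ "- _"])
  have "inv\<^bsub>real_add_group\<^esub> g = - g"
    by (rule A.inv_equality) (auto simp: real_add_group_def)
  then show ?thesis using subgroup.m_inv_closed[OF subgroup_G assms] by simp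
qed

lemma N_carrier_iff:
  "a \<in> carrier N \<longleftrightarrow>
    (\<forall>g. a g \<in> carrier K) \<and> (\<forall>g. g \<notin> G \<longrightarrow> a g = \<zero>) \<and> lfin {g. a g \<noteq> \<zero>}"
proof -
  have "(\<forall>C>0. finite {g. a g \<noteq> \<zero> \<and> g < C}) \<longleftrightarrow> lfin {g. a g \<noteq> \<zero>}"
  proof
    assume fin: "\<forall>C>0. finite {g. a g \<noteq> \<zero> \<and> g < C}"
    show "lfin {g. a g \<noteq> \<zero>}"
      unfolding lfin_def
    proof
      fix C
      have "finite {g. a g \<noteq> \<zero> \<and> g < max C 1}" using fin by simp
      then show "finite ({g. a g \<noteq> \<zero>} \<inter> {..<C})" by (rule rev_finite_subset) auto
    qed
  next
    assume "lfin {g. a g \<noteq> \<zero>}"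
    then show "\<forall>C>0. finite {g. a g \<noteq> \<zero> \<and> g < C}"
      by (simp add: lfin_def Int_def)
  qed
  then show ?thesis by (simp add: novikov_ring_def)
qed

lemma N_coeff_closed: "a \<in> carrier N \<Longrightarrow> a g \<in> carrier K"
  by (simp add: N_carrier_iff)

lemma N_add: "(a \<oplus>\<^bsub>N\<^esub> b) g = a g \<oplus> b g"
  by (simp add: novikov_ring_def)

lemma N_zero: "\<zero>\<^bsub>N\<^esub> g = \<zero>"
  by (simp add: novikov_ring_def)

lemma N_mult:
  "(a \<otimes>\<^bsub>N\<^esub> b) k = (\<Oplus>g\<in>{g. a g \<noteq> \<zero> \<and> b (k - g) \<noteq> \<zero>}. a g \<otimes> b (k - g))"
  by (simp add: novikov_ring_def)

lemma N_add_closed: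
  assumes "a \<in> carrier N" "b \<in> carrier N"
  shows "(\<lambda>g. a g \<oplus> b g) \<in> carrier N"
proof -
  have "lfin ({g. a g \<noteq> \<zero>} \<union> {g. b g \<noteq> \<zero>})"
    using assms by (intro lfin_Un) (auto simp: N_carrier_iff)
  then have "lfin {g. a g \<oplus> b g \<noteq> \<zero>}" by (rule lfin_subset) auto
  then show ?thesis using assms by (simp add: N_carrier_iff)
qed

text \<open>The series \<open>\<lambda>g. c \<otimes> a (g - h)\<close> is the product of \<open>a\<close> with the monomial \<open>c T\<^sup>h\<close>.\<close>

lemma N_scale_closed:
  assumes "a \<in> carrier N" "c \<in> carrier K" "h \<in> G"
  shows "(\<lambda>g. c \<otimes> a (g - h)) \<in> carrier N"
proof -
  have "lfin ((\<lambda>s. s + h) ` {g. a g \<noteq> \<zero>})"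
    using assms by (intro lfin_shift) (auto simp: N_carrier_iff)
  moreover have "{g. c \<otimes> a (g - h) \<noteq> \<zero>} \<subseteq> (\<lambda>s. s + h) ` {g. a g \<noteq> \<zero>}"
  proof
    fix g assume "g \<in> {g. c \<otimes> a (g - h) \<noteq> \<zero>}"
    then have "a (g - h) \<noteq> \<zero>" using assms(2) by auto
    then show "g \<in> (\<lambda>s. s + h) ` {g. a g \<noteq> \<zero>}" by (intro image_eqI[of _ _ "g - h"]) auto
  qed
  ultimately have "lfin {g. c \<otimes> a (g - h) \<noteq> \<zero>}" by (rule lfin_subset)
  moreover have "a (g - h) = \<zero>" if "g \<notin> G" for g
    using G_add[of "g - h" h] assms that by (auto simp: N_carrier_iff)
  ultimately show ?thesis using assms by (auto simp: N_carrier_iff)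
qed

lemma N_uminus_closed:
  assumes "a \<in> carrier N"
  shows "(\<lambda>g. \<ominus> a g) \<in> carrier N"
  using N_scale_closed[OF assms, of "\<ominus> \<one>" 0] G_zero N_coeff_closed[OF assms]
  by (simp add: l_minus)

lemma abelian_group_N: "abelian_group N"
proof (rule abelian_groupI)
  fix a assume a: "a \<in> carrier N"
  have "(\<lambda>g. \<ominus> a g) \<oplus>\<^bsub>N\<^esub> a = \<zero>\<^bsub>N\<^esub>"
    by (rule ext) (simp add: N_add N_zero N_coeff_closed[OF a] l_neg)
  then show "\<exists>b\<in>carrier N. b \<oplus>\<^bsub>N\<^esub> a = \<zero>\<^bsub>N\<^esub>"
    using N_uminus_closed[OF a] by blast
next
  show "\<zero>\<^bsub>N\<^esub> \<in> carrier N"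
    by (simp add: N_carrier_iff N_zero lfin_def)
next
  fix a b assume "a \<in> carrier N" "b \<in> carrier N"
  then show "a \<oplus>\<^bsub>N\<^esub> b \<in> carrier N"
    using N_add_closed by (simp add: novikov_ring_def)
qed (auto simp: fun_eq_iff N_add N_zero N_coeff_closed a_ac)

lemma N_minus:
  assumes "a \<in> carrier N" "b \<in> carrier N"
  shows "(a \<ominus>\<^bsub>N\<^esub> b) g = a g \<ominus> b g"
proof -
  interpret N: abelian_group N by (rule abelian_group_N)
  have "(\<lambda>g. \<ominus> b g) \<oplus>\<^bsub>N\<^esub> b = \<zero>\<^bsub>N\<^esub>"
    by (rule ext) (simp add: N_add N_zero N_coeff_closed[OF assms(2)] l_neg)
  then have "\<ominus>\<^bsub>N\<^esub> b = (\<lambda>g. \<ominus> b g)"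
    using N.minus_equality N_uminus_closed assms(2) by blast
  then show ?thesis by (simp add: a_minus_def N_add)
qed

lemma N_finsum:
  assumes "finite J" "\<And>j. j \<in> J \<Longrightarrow> f j \<in> carrier N"
  shows "(\<Oplus>\<^bsub>N\<^esub>j\<in>J. f j) g = (\<Oplus>j\<in>J. f j g)"
proof -
  interpret N: abelian_group N by (rule abelian_group_N)
  show ?thesis
    using assms
    by (induction J rule: finite_induct) (auto simp: N_zero N_add N_coeff_closed Pi_def)
qed

lemma N_mult_index_finite:
  assumes "a \<in> carrier N" "b \<in> carrier N"
  shows "finite {g. a g \<noteq> \<zero> \<and> b (k - g) \<noteq> \<zero>}"
proof -
  obtain s where s: "{g. b g \<noteq> \<zero>} \<subseteq> {s..}"
    using assms(2) lfin_lower_bound by (auto simp: N_carrier_iff)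
  have "finite ({g. a g \<noteq> \<zero>} \<inter> {..<k - s + 1})"
    using assms(1) by (simp add: N_carrier_iff lfin_def)
  moreover have "{g. a g \<noteq> \<zero> \<and> b (k - g) \<noteq> \<zero>} \<subseteq> {g. a g \<noteq> \<zero>} \<inter> {..<k - s + 1}"
    using s by force
  ultimately show ?thesis by (rule rev_finite_subset)
qed

text \<open>The index set of the convolution depends on the factors; summing over a common larger set is what
  makes the bilinearity of the product provable termwise.\<close>

lemma N_mult_over:
  assumes "a \<in> carrier N" "b \<in> carrier N" "finite S"
    and "{g. a g \<noteq> \<zero> \<and> b (k - g) \<noteq> \<zero>} \<subseteq> S"
  shows "(a \<otimes>\<^bsub>N\<^esub> b) k = (\<Oplus>g\<in>S. a g \<otimes> b (k - g))"
  unfolding N_mult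
proof (rule add.finprod_mono_neutral_cong_left[OF assms(3,4)])
  fix g assume "g \<in> S - {g. a g \<noteq> \<zero> \<and> b (k - g) \<noteq> \<zero>}"
  then show "a g \<otimes> b (k - g) = \<zero>"
    using assms(1,2) by (auto simp: N_coeff_closed)
qed (use assms(1,2) in \<open>auto simp: N_coeff_closed\<close>)

lemma N_mult_nonzero:
  assumes "(a \<otimes>\<^bsub>N\<^esub> b) k \<noteq> \<zero>"
  obtains g where "a g \<noteq> \<zero>" "b (k - g) \<noteq> \<zero>"
proof (cases "{g. a g \<noteq> \<zero> \<and> b (k - g) \<noteq> \<zero>} = {}")
  case True
  then show ?thesis using assms unfolding N_mult True by simp
qed (use that in blast)

lemma N_mult_closed:
  assumes a: "a \<in> carrier N" and b: "b \<in> carrier N"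
  shows "a \<otimes>\<^bsub>N\<^esub> b \<in> carrier N"
  unfolding N_carrier_iff
proof (intro conjI allI impI)
  fix k
  show "(a \<otimes>\<^bsub>N\<^esub> b) k \<in> carrier K"
    unfolding N_mult using a b by (intro finsum_closed) (auto simp: N_coeff_closed)
  show "(a \<otimes>\<^bsub>N\<^esub> b) k = \<zero>" if "k \<notin> G"
  proof (rule ccontr)
    assume "(a \<otimes>\<^bsub>N\<^esub> b) k \<noteq> \<zero>"
    then obtain g where "a g \<noteq> \<zero>" "b (k - g) \<noteq> \<zero>" by (rule N_mult_nonzero)
    then have "g \<in> G" "k - g \<in> G" using a b by (auto simp: N_carrier_iff)
    then show False using G_add[of g "k - g"] that by simp
  qed
next
  obtain r where r: "{g. a g \<noteq> \<zero>} \<subseteq> {r..}"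
    using a lfin_lower_bound by (auto simp: N_carrier_iff)
  obtain s where s: "{g. b g \<noteq> \<zero>} \<subseteq> {s..}"
    using b lfin_lower_bound by (auto simp: N_carrier_iff)
  show "lfin {k. (a \<otimes>\<^bsub>N\<^esub> b) k \<noteq> \<zero>}"
    unfolding lfin_def
  proof
    fix C
    let ?S = "({g. a g \<noteq> \<zero>} \<inter> {..<C - s}) \<times> ({g. b g \<noteq> \<zero>} \<inter> {..<C - r})"
    have "{k. (a \<otimes>\<^bsub>N\<^esub> b) k \<noteq> \<zero>} \<inter> {..<C} \<subseteq> (\<lambda>(g, h). g + h) ` ?S"
    proof
      fix k assume k: "k \<in> {k. (a \<otimes>\<^bsub>N\<^esub> b) k \<noteq> \<zero>} \<inter> {..<C}"
      then obtain g where g: "a g \<noteq> \<zero>" "b (k - g) \<noteq> \<zero>" using N_mult_nonzero by blast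
      then have "r \<le> g" "s \<le> k - g" using r s by auto
      then have "(g, k - g) \<in> ?S" using g k by auto
      then show "k \<in> (\<lambda>(g, h). g + h) ` ?S" by force
    qed
    moreover have "finite ?S" using a b by (auto simp: N_carrier_iff lfin_def)
    ultimately show "finite ({k. (a \<otimes>\<^bsub>N\<^esub> b) k \<noteq> \<zero>} \<inter> {..<C})"
      using finite_surj by blast
  qed
qed

lemma N_mult_add_right:
  assumes a: "a \<in> carrier N" and b: "b \<in> carrier N" and c: "c \<in> carrier N"
  shows "(a \<otimes>\<^bsub>N\<^esub> (\<lambda>g. b g \<oplus> c g)) k = (a \<otimes>\<^bsub>N\<^esub> b) k \<oplus> (a \<otimes>\<^bsub>N\<^esub> c) k"
proof -
  define S where
    "S = {g. a g \<noteq> \<zero> \<and> b (k - g) \<noteq> \<zero>} \<union> {g. a g \<noteq> \<zero> \<and> c (k - g) \<noteq> \<zero>}"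
  have S: "finite S" unfolding S_def using N_mult_index_finite a b c by blast
  have "(a \<otimes>\<^bsub>N\<^esub> (\<lambda>g. b g \<oplus> c g)) k = (\<Oplus>g\<in>S. a g \<otimes> (b (k - g) \<oplus> c (k - g)))"
    by (rule N_mult_over[OF a N_add_closed[OF b c] S]) (auto simp: S_def)
  also have "\<dots> = (\<Oplus>g\<in>S. a g \<otimes> b (k - g) \<oplus> a g \<otimes> c (k - g))"
    using a b c by (intro finsum_cong') (auto simp: N_coeff_closed r_distr)
  also have "\<dots> = (\<Oplus>g\<in>S. a g \<otimes> b (k - g)) \<oplus> (\<Oplus>g\<in>S. a g \<otimes> c (k - g))"
    using a b c by (intro finsum_addf) (auto simp: N_coeff_closed)
  also have "(\<Oplus>g\<in>S. a g \<otimes> b (k - g)) = (a \<otimes>\<^bsub>N\<^esub> b) k"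
    by (rule N_mult_over[symmetric, OF a b S]) (auto simp: S_def)
  also have "(\<Oplus>g\<in>S. a g \<otimes> c (k - g)) = (a \<otimes>\<^bsub>N\<^esub> c) k"
    by (rule N_mult_over[symmetric, OF a c S]) (auto simp: S_def)
  finally show ?thesis .
qed

lemma N_mult_scale_right:
  assumes a: "a \<in> carrier N" and b: "b \<in> carrier N" and c: "c \<in> carrier K" and h: "h \<in> G"
  shows "(a \<otimes>\<^bsub>N\<^esub> (\<lambda>g. c \<otimes> b (g - h))) k = c \<otimes> (a \<otimes>\<^bsub>N\<^esub> b) (k - h)"
proof -
  define S where "S = {g. a g \<noteq> \<zero> \<and> b (k - h - g) \<noteq> \<zero>}"
  have S: "finite S" unfolding S_def using N_mult_index_finite a b by blast
  have eq: "k - g - h = k - h - g" for g by simp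
  have "(a \<otimes>\<^bsub>N\<^esub> (\<lambda>g. c \<otimes> b (g - h))) k = (\<Oplus>g\<in>S. a g \<otimes> (c \<otimes> b (k - g - h)))"
    by (rule N_mult_over[OF a N_scale_closed[OF b c h] S]) (use c in \<open>auto simp: S_def eq\<close>)
  also have "\<dots> = (\<Oplus>g\<in>S. c \<otimes> (a g \<otimes> b (k - h - g)))"
    unfolding eq using a b c by (intro finsum_cong') (auto simp: N_coeff_closed m_ac)
  also have "\<dots> = c \<otimes> (\<Oplus>g\<in>S. a g \<otimes> b (k - h - g))"
    using a b c S by (intro finsum_rdistr[symmetric]) (auto simp: N_coeff_closed)
  also have "(\<Oplus>g\<in>S. a g \<otimes> b (k - h - g)) = (a \<otimes>\<^bsub>N\<^esub> b) (k - h)"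
    by (rule N_mult_over[symmetric, OF a b S]) (auto simp: S_def)
  finally show ?thesis .
qed

section \<open>Vectors over the Novikov ring and their supports\<close>

definition vecs :: "nat \<Rightarrow> (nat \<Rightarrow> real \<Rightarrow> 'a) set"
  where "vecs k = {x. \<forall>i<k. x i \<in> carrier N}"

text \<open>The support with respect to the shift \<open>t\<close>: the monomial \<open>T\<^sup>g\<close> in position \<open>i\<close> contributes
  \<open>g - t i\<close>, so that the shifted valuation of \<open>x\<close> is the minimum of this set. Inclusions in
  \<open>{s..}\<close> and \<open>{s<..}\<close> thus express that the valuation is at least, respectively greater than, \<open>s\<close>.\<close>

definition vsupp :: "nat \<Rightarrow> (nat \<Rightarrow> real) \<Rightarrow> (nat \<Rightarrow> real \<Rightarrow> 'a) \<Rightarrow> real set"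
  where "vsupp k t x = {r. \<exists>i<k. x i (r + t i) \<noteq> \<zero>}"

definition vadd :: "(nat \<Rightarrow> real \<Rightarrow> 'a) \<Rightarrow> (nat \<Rightarrow> real \<Rightarrow> 'a) \<Rightarrow> nat \<Rightarrow> real \<Rightarrow> 'a"
  where "vadd x y = (\<lambda>i g. x i g \<oplus> y i g)"

definition vsub :: "(nat \<Rightarrow> real \<Rightarrow> 'a) \<Rightarrow> (nat \<Rightarrow> real \<Rightarrow> 'a) \<Rightarrow> nat \<Rightarrow> real \<Rightarrow> 'a"
  where "vsub x y = (\<lambda>i g. x i g \<ominus> y i g)"

text \<open>Multiplication by the monomial \<open>c T\<^sup>h\<close>.\<close>

definition vscale :: "'a \<Rightarrow> real \<Rightarrow> (nat \<Rightarrow> real \<Rightarrow> 'a) \<Rightarrow> nat \<Rightarrow> real \<Rightarrow> 'a"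
  where "vscale c h x = (\<lambda>i g. c \<otimes> x i (g - h))"

lemma vadd_apply: "vadd x y i g = x i g \<oplus> y i g"
  by (simp add: vadd_def)

lemma vsub_apply: "vsub x y i g = x i g \<ominus> y i g"
  by (simp add: vsub_def)

lemma vecs_coeff_closed: "x \<in> vecs k \<Longrightarrow> i < k \<Longrightarrow> x i g \<in> carrier K"
  by (simp add: vecs_def N_coeff_closed)

lemma vzero_closed: "(\<lambda>i g. \<zero>) \<in> vecs k"
  by (simp add: vecs_def N_carrier_iff lfin_def)

lemma vadd_closed: "x \<in> vecs k \<Longrightarrow> y \<in> vecs k \<Longrightarrow> vadd x y \<in> vecs k"
  by (simp add: vecs_def vadd_def N_add_closed)

lemma vsub_closed: "x \<in> vecs k \<Longrightarrow> y \<in> vecs k \<Longrightarrow> vsub x y \<in> vecs k"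
  by (simp add: vecs_def vsub_def a_minus_def N_add_closed N_uminus_closed)

lemma vscale_closed: "x \<in> vecs k \<Longrightarrow> c \<in> carrier K \<Longrightarrow> h \<in> G \<Longrightarrow> vscale c h x \<in> vecs k"
  by (simp add: vecs_def vscale_def N_scale_closed)

lemma vsupp_vadd: "vsupp k t (vadd x y) \<subseteq> vsupp k t x \<union> vsupp k t y"
  by (auto simp: vsupp_def vadd_def)

lemma vsupp_vsub: "vsupp k t (vsub x y) \<subseteq> vsupp k t x \<union> vsupp k t y"
  by (auto simp: vsupp_def vsub_def a_minus_def)

lemma vsupp_vscale:
  assumes "c \<in> carrier K"
  shows "vsupp k t (vscale c h x) \<subseteq> (\<lambda>r. r + h) ` vsupp k t x"
proof
  fix r assume "r \<in> vsupp k t (vscale c h x)"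
  then obtain i where "i < k" "c \<otimes> x i (r + t i - h) \<noteq> \<zero>" by (auto simp: vsupp_def vscale_def)
  moreover have "r + t i - h = r - h + t i" by simp
  ultimately have "i < k" "x i (r - h + t i) \<noteq> \<zero>" using assms by auto
  then have "r - h \<in> vsupp k t x" by (auto simp: vsupp_def)
  then show "r \<in> (\<lambda>r. r + h) ` vsupp k t x" by (intro image_eqI[of _ _ "r - h"]) auto
qed

lemma vsupp_cong: "(\<And>i g. i < k \<Longrightarrow> x i g = y i g) \<Longrightarrow> vsupp k t x = vsupp k t y"
  by (simp add: vsupp_def cong: conj_cong)

lemma vsupp_coeff_zero:
  assumes "i < k" "g - t i \<notin> vsupp k t x"
  shows "x i g = \<zero>"
  using assms by (auto simp: vsupp_def)

lemma lfin_vsupp: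
  assumes "x \<in> vecs k"
  shows "lfin (vsupp k t x)"
proof (rule lfin_subset)
  show "vsupp k t x \<subseteq> (\<Union>i\<in>{..<k}. (\<lambda>g. g + - t i) ` {g. x i g \<noteq> \<zero>})"
    by (force simp: vsupp_def)
  show "lfin (\<Union>i\<in>{..<k}. (\<lambda>g. g + - t i) ` {g. x i g \<noteq> \<zero>})"
    using assms by (intro lfin_UN lfin_shift) (auto simp: vecs_def N_carrier_iff)
qed

end

section \<open>The action of a matrix\<close>

locale novikov_matrix = novikov K G + noetherian_ring K
  for K :: "('a, 'b) ring_scheme" (structure) and G +
  fixes n m :: nat and A :: "nat \<Rightarrow> nat \<Rightarrow> real \<Rightarrow> 'a" and t :: "nat \<Rightarrow> real"
  assumes A_closed: "\<And>i j. i < n \<Longrightarrow> j < m \<Longrightarrow> A i j \<in> carrier N"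
begin

text \<open>The product of the matrix with a vector that need not be extensional, given by its
  coefficients.\<close>

definition act :: "(nat \<Rightarrow> real \<Rightarrow> 'a) \<Rightarrow> nat \<Rightarrow> real \<Rightarrow> 'a"
  where "act x = (\<lambda>i g. \<Oplus>j\<in>{..<m}. (A i j \<otimes>\<^bsub>N\<^esub> x j) g)"

lemma act_eq_finsum:
  assumes "x \<in> vecs m" "i < n"
  shows "act x i = (\<Oplus>\<^bsub>N\<^esub>j\<in>{..<m}. A i j \<otimes>\<^bsub>N\<^esub> x j)"
  by (rule ext)
    (use assms A_closed in \<open>auto simp: act_def vecs_def intro!: N_finsum[symmetric] N_mult_closed\<close>)

lemma act_closed:
  assumes "x \<in> vecs m"
  shows "act x \<in> vecs n"
proof -
  interpret N: abelian_group N by (rule abelian_group_N)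
  have "(\<Oplus>\<^bsub>N\<^esub>j\<in>{..<m}. A i j \<otimes>\<^bsub>N\<^esub> x j) \<in> carrier N" if "i < n" for i
    using assms that A_closed by (intro N.finsum_closed) (auto simp: vecs_def N_mult_closed)
  then show ?thesis using assms by (simp add: vecs_def[of n] act_eq_finsum)
qed

lemma act_cong:
  assumes "\<And>j. j < m \<Longrightarrow> x j = y j" "x \<in> vecs m" "i < n"
  shows "act x i g = act y i g"
proof -
  have "(A i j \<otimes>\<^bsub>N\<^esub> y j) g \<in> carrier K" if "j < m" for j
    using assms A_closed that N_mult_closed N_coeff_closed by (simp add: vecs_def)
  then show ?thesis
    unfolding act_def using assms(1) by (intro finsum_cong') auto
qed

lemma act_add:
  assumes x: "x \<in> vecs m" and y: "y \<in> vecs m" and i: "i < n"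
  shows "act (vadd x y) i g = act x i g \<oplus> act y i g"
proof -
  have cl: "(A i j \<otimes>\<^bsub>N\<^esub> z j) g \<in> carrier K" if "z \<in> vecs m" "j < m" for z j
    using that i A_closed N_mult_closed N_coeff_closed by (simp add: vecs_def)
  have "act (vadd x y) i g = (\<Oplus>j\<in>{..<m}. (A i j \<otimes>\<^bsub>N\<^esub> x j) g \<oplus> (A i j \<otimes>\<^bsub>N\<^esub> y j) g)"
    unfolding act_def
  proof (intro finsum_cong')
    fix j assume "j \<in> {..<m}"
    then show "(A i j \<otimes>\<^bsub>N\<^esub> vadd x y j) g = (A i j \<otimes>\<^bsub>N\<^esub> x j) g \<oplus> (A i j \<otimes>\<^bsub>N\<^esub> y j) g"
      using x y i A_closed by (simp add: vadd_def vecs_def N_mult_add_right)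
  qed (use cl x y in auto)
  also have "\<dots> = act x i g \<oplus> act y i g"
    unfolding act_def using cl x y by (intro finsum_addf) auto
  finally show ?thesis .
qed

lemma act_scale:
  assumes x: "x \<in> vecs m" and c: "c \<in> carrier K" and h: "h \<in> G" and i: "i < n"
  shows "act (vscale c h x) i g = c \<otimes> act x i (g - h)"
proof -
  have cl: "(A i j \<otimes>\<^bsub>N\<^esub> x j) k \<in> carrier K" if "j < m" for j k
    using that x i A_closed N_mult_closed N_coeff_closed by (simp add: vecs_def)
  have "act (vscale c h x) i g = (\<Oplus>j\<in>{..<m}. c \<otimes> (A i j \<otimes>\<^bsub>N\<^esub> x j) (g - h))"
    unfolding act_def
  proof (intro finsum_cong')
    fix j assume "j \<in> {..<m}"
    then show "(A i j \<otimes>\<^bsub>N\<^esub> vscale c h x j) g = c \<otimes> (A i j \<otimes>\<^bsub>N\<^esub> x j) (g - h)"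
      using x i A_closed c h by (simp add: vscale_def vecs_def N_mult_scale_right)
  qed (use cl c in auto)
  also have "\<dots> = c \<otimes> act x i (g - h)"
    unfolding act_def using cl c by (intro finsum_rdistr[symmetric]) auto
  finally show ?thesis .
qed

lemma act_sub:
  assumes x: "x \<in> vecs m" and y: "y \<in> vecs m" and i: "i < n"
  shows "act (vsub x y) i g = act x i g \<ominus> act y i g"
proof -
  have cl: "act z i g \<in> carrier K" if "z \<in> vecs m" for z
    using act_closed[OF that] i by (rule vecs_coeff_closed)
  have "x j g \<ominus> y j g \<oplus> y j g = x j g" if "j < m" for j g
    using vecs_coeff_closed[OF x that] vecs_coeff_closed[OF y that]
    by (simp add: a_minus_def a_assoc l_neg)
  then have "act x i g = act (vadd (vsub x y) y) i g"
    by (intro act_cong) (auto simp: x i vadd_def vsub_def fun_eq_iff)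
  also have "\<dots> = act (vsub x y) i g \<oplus> act y i g"
    using x y i by (simp add: act_add vsub_closed)
  finally show ?thesis
    using cl[OF y] cl[OF vsub_closed[OF x y]] by (simp add: a_minus_def a_assoc r_neg)
qed

text \<open>The matrix lowers valuations by at most a constant, namely a lower bound for all its
  exponents. This is what allows passing to limits under it.\<close>

lemma act_lower_bound:
  "\<exists>\<kappa>. \<forall>x s. (\<forall>j<m. \<forall>h<s. x j h = \<zero>) \<longrightarrow> (\<forall>i<n. \<forall>g<s + \<kappa>. act x i g = \<zero>)"
proof -
  have "lfin (\<Union>i\<in>{..<n}. \<Union>j\<in>{..<m}. {g. A i j g \<noteq> \<zero>})"
    using A_closed by (intro lfin_UN) (auto simp: N_carrier_iff)
  then obtain \<kappa> where "(\<Union>i\<in>{..<n}. \<Union>j\<in>{..<m}. {g. A i j g \<noteq> \<zero>}) \<subseteq> {\<kappa>..}"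
    using lfin_lower_bound by blast
  then have \<kappa>: "\<kappa> \<le> h" if "i < n" "j < m" "A i j h \<noteq> \<zero>" for i j h
    using that by fastforce
  have "act x i g = \<zero>"
    if x: "\<And>j h. j < m \<Longrightarrow> h < s \<Longrightarrow> x j h = \<zero>" and i: "i < n" and g: "g < s + \<kappa>" for x s i g
  proof -
    have "(A i j \<otimes>\<^bsub>N\<^esub> x j) g = \<zero>" if j: "j < m" for j
    proof (rule ccontr)
      assume "(A i j \<otimes>\<^bsub>N\<^esub> x j) g \<noteq> \<zero>"
      then obtain h where "A i j h \<noteq> \<zero>" "x j (g - h) \<noteq> \<zero>" by (rule N_mult_nonzero)
      then show False using \<kappa>[OF i j] x[OF j, of "g - h"] g by fastforce
    qed
    then have "act x i g = (\<Oplus>j\<in>{..<m}. \<zero>)"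
      unfolding act_def by (intro finsum_cong') auto
    then show ?thesis by simp
  qed
  then show ?thesis by blast
qed

lemma act_zero:
  assumes "i < n"
  shows "act (\<lambda>j g. \<zero>) i g = \<zero>"
proof -
  obtain \<kappa> where \<kappa>:
    "\<forall>x s. (\<forall>j<m. \<forall>h<s. x j h = \<zero>) \<longrightarrow> (\<forall>i<n. \<forall>g<s + \<kappa>. act x i g = \<zero>)"
    using act_lower_bound by blast
  show ?thesis
    by (rule \<kappa>[rule_format, of "g - \<kappa> + 1"]) (use assms in auto)
qed

lemma vsupp_act_add:
  assumes "x \<in> vecs m" "y \<in> vecs m"
  shows "vsupp n t (act (vadd x y)) \<subseteq> vsupp n t (act x) \<union> vsupp n t (act y)"
proof -
  have "vsupp n t (act (vadd x y)) = vsupp n t (vadd (act x) (act y))"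
    using assms by (intro vsupp_cong) (simp add: act_add vadd_def[of "act x"])
  then show ?thesis using vsupp_vadd by simp
qed

lemma vsupp_act_scale:
  assumes "x \<in> vecs m" "c \<in> carrier K" "h \<in> G"
  shows "vsupp n t (act (vscale c h x)) \<subseteq> (\<lambda>r. r + h) ` vsupp n t (act x)"
proof -
  have "vsupp n t (act (vscale c h x)) = vsupp n t (vscale c h (act x))"
    using assms by (intro vsupp_cong) (simp add: act_scale vscale_def[of c h "act x"])
  then show ?thesis using vsupp_vscale[OF assms(2)] by simp
qed

section \<open>Ideals of leading coefficients\<close>

text \<open>The leading term of \<open>act z\<close> is moved to the monomial \<open>T\<^sup>0\<close> in position \<open>i\<close>, whose shifted exponent is
  \<open>- t i\<close>. With \<open>P \<subseteq> {0..}\<close>, the condition on the support leaves no smaller shifted exponent, and the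
  last one says that the positions before \<open>i\<close> have no term of shifted exponent \<open>- t i\<close>. The bounds
  \<open>\<gamma>\<close> on \<open>z\<close> and \<open>P\<close> on the whole support of \<open>act z\<close> record the cost of using \<open>z\<close> for a cancellation.\<close>

definition lead :: "nat \<Rightarrow> real \<Rightarrow> real set \<Rightarrow> 'a set"
  where "lead i \<gamma> P = {act z i 0 | z. z \<in> vecs m \<and> vsupp m (\<lambda>j. 0) z \<subseteq> {\<gamma>..} \<and>
    (\<forall>r\<in>vsupp n t (act z). r + t i \<in> P) \<and> (\<forall>j<i. act z j (t j - t i) = \<zero>)}"

lemma leadI:
  assumes "z \<in> vecs m" "vsupp m (\<lambda>j. 0) z \<subseteq> {\<gamma>..}" "\<And>r. r \<in> vsupp n t (act z) \<Longrightarrow> r + t i \<in> P"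
    and "\<And>j. j < i \<Longrightarrow> act z j (t j - t i) = \<zero>" "act z i 0 = c"
  shows "c \<in> lead i \<gamma> P"
  using assms unfolding lead_def by blast

lemma leadE:
  assumes "c \<in> lead i \<gamma> P"
  obtains z where "z \<in> vecs m" "vsupp m (\<lambda>j. 0) z \<subseteq> {\<gamma>..}"
    "\<forall>r\<in>vsupp n t (act z). r + t i \<in> P"
    "\<forall>j<i. act z j (t j - t i) = \<zero>" "act z i 0 = c"
  using assms unfolding lead_def by blast

lemma lead_mono:
  assumes "\<gamma>' \<le> \<gamma>" "P \<subseteq> P'"
  shows "lead i \<gamma> P \<subseteq> lead i \<gamma>' P'"
proof
  fix c assume "c \<in> lead i \<gamma> P"
  then obtain z where z: "z \<in> vecs m" "vsupp m (\<lambda>j. 0) z \<subseteq> {\<gamma>..}"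
    "\<forall>r\<in>vsupp n t (act z). r + t i \<in> P"
    "\<forall>j<i. act z j (t j - t i) = \<zero>" "act z i 0 = c"
    by (rule leadE)
  show "c \<in> lead i \<gamma>' P'"
  proof (rule leadI[OF z(1)])
    show "vsupp m (\<lambda>j. 0) z \<subseteq> {\<gamma>'..}" using z(2) assms(1) by force
  qed (use z assms(2) in auto)
qed

lemma ideal_lead:
  assumes i: "i < n"
  shows "ideal (lead i \<gamma> P) K"
proof -
  have mult: "c \<otimes> a \<in> lead i \<gamma> P" if c: "c \<in> carrier K" and a: "a \<in> lead i \<gamma> P" for c a
  proof -
    obtain z where z: "z \<in> vecs m" "vsupp m (\<lambda>j. 0) z \<subseteq> {\<gamma>..}"
      "\<forall>r\<in>vsupp n t (act z). r + t i \<in> P"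
      "\<forall>j<i. act z j (t j - t i) = \<zero>" "act z i 0 = a"
      using a by (rule leadE)
    show ?thesis
    proof (rule leadI[of "vscale c 0 z"])
      show "vscale c 0 z \<in> vecs m" using z(1) c G_zero by (rule vscale_closed)
      show "vsupp m (\<lambda>j. 0) (vscale c 0 z) \<subseteq> {\<gamma>..}"
        using vsupp_vscale[OF c, of m "\<lambda>j. 0" 0 z] z(2) by auto
      show "r + t i \<in> P" if "r \<in> vsupp n t (act (vscale c 0 z))" for r
        using vsupp_act_scale[OF z(1) c G_zero] z(3) that by auto
      show "act (vscale c 0 z) j (t j - t i) = \<zero>" if "j < i" for j
        using act_scale[OF z(1) c G_zero] z(4)[rule_format, OF that] that i c by simp
      show "act (vscale c 0 z) i 0 = c \<otimes> a"
        using act_scale[OF z(1) c G_zero i] z(5) by simp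
    qed
  qed
  have carr: "lead i \<gamma> P \<subseteq> carrier K"
    using vecs_coeff_closed[OF act_closed i] by (auto simp: lead_def)
  show ?thesis
  proof (rule idealI)
    show "subgroup (lead i \<gamma> P) (add_monoid K)"
    proof (rule add.subgroupI)
      have "\<zero> \<in> lead i \<gamma> P"
        using i by (intro leadI[OF vzero_closed]) (auto simp: vsupp_def act_zero)
      then show "lead i \<gamma> P \<noteq> {}" by blast
    next
      fix a assume a: "a \<in> lead i \<gamma> P"
      then have "a \<in> carrier K" using carr by blast
      then show "\<ominus> a \<in> lead i \<gamma> P" using mult[OF _ a, of "\<ominus> \<one>"] by (simp add: l_minus)
    next
      fix a b assume ab: "a \<in> lead i \<gamma> P" "b \<in> lead i \<gamma> P"
      obtain y where y: "y \<in> vecs m" "vsupp m (\<lambda>j. 0) y \<subseteq> {\<gamma>..}"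
        "\<forall>r\<in>vsupp n t (act y). r + t i \<in> P"
        "\<forall>j<i. act y j (t j - t i) = \<zero>" "act y i 0 = a"
        using ab(1) by (rule leadE)
      obtain z where z: "z \<in> vecs m" "vsupp m (\<lambda>j. 0) z \<subseteq> {\<gamma>..}"
        "\<forall>r\<in>vsupp n t (act z). r + t i \<in> P"
        "\<forall>j<i. act z j (t j - t i) = \<zero>" "act z i 0 = b"
        using ab(2) by (rule leadE)
      show "a \<oplus> b \<in> lead i \<gamma> P"
      proof (rule leadI[of "vadd y z"])
        show "vadd y z \<in> vecs m" using y(1) z(1) by (rule vadd_closed)
        show "vsupp m (\<lambda>j. 0) (vadd y z) \<subseteq> {\<gamma>..}"
          using vsupp_vadd[of m "\<lambda>j. 0" y z] y(2) z(2) by blast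
        show "r + t i \<in> P" if "r \<in> vsupp n t (act (vadd y z))" for r
          using vsupp_act_add[OF y(1) z(1)] y(3) z(3) that by blast
        show "act (vadd y z) j (t j - t i) = \<zero>" if "j < i" for j
          using act_add[OF y(1) z(1)] y(4)[rule_format, OF that] z(4)[rule_format, OF that] that i by simp
        show "act (vadd y z) i 0 = a \<oplus> b"
          using act_add[OF y(1) z(1) i] y(5) z(5) by simp
      qed
    qed (use carr in auto)
  next
    fix a c assume "a \<in> lead i \<gamma> P" "c \<in> carrier K"
    moreover from this have "a \<otimes> c = c \<otimes> a" using carr m_comm by blast
    ultimately show "c \<otimes> a \<in> lead i \<gamma> P" "a \<otimes> c \<in> lead i \<gamma> P"
      using mult by simp_all
  qed (rule ring_axioms)
qed

text \<open>A uniform cost suffices for all leading coefficients in position \<open>i\<close>. This is the only place where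
  finite generation of ideals enters.\<close>

lemma lead_stabilises:
  assumes "i < n"
  shows "\<exists>\<gamma> P. lfin P \<and> P \<subseteq> {0..} \<and>
    (\<forall>\<gamma>' P'. lfin P' \<longrightarrow> P' \<subseteq> {0..} \<longrightarrow> lead i \<gamma>' P' \<subseteq> lead i \<gamma> P)"
proof -
  define \<J> where "\<J> = {lead i \<gamma> P | \<gamma> P. lfin P \<and> P \<subseteq> {0..}}"
  obtain I where I: "I \<in> \<J>" "\<And>J. J \<in> \<J> \<Longrightarrow> J \<subseteq> I"
  proof (rule directed_family_of_ideals_has_greatest[of \<J>])
    have "lfin {}" by (simp add: lfin_def)
    then show "\<J> \<noteq> {}" by (force simp: \<J>_def)
    show "ideal I K" if "I \<in> \<J>" for I
      using that ideal_lead[OF assms] by (auto simp: \<J>_def)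
  next
    fix I J assume "I \<in> \<J>" "J \<in> \<J>"
    then obtain \<gamma> P \<delta> Q where IJ: "I = lead i \<gamma> P" "J = lead i \<delta> Q"
      and fin: "lfin P" "P \<subseteq> {0..}" "lfin Q" "Q \<subseteq> {0..}"
      unfolding \<J>_def by blast
    have "lead i (min \<gamma> \<delta>) (P \<union> Q) \<in> \<J>"
      using fin lfin_Un[of P Q] unfolding \<J>_def by blast
    moreover have "I \<subseteq> lead i (min \<gamma> \<delta>) (P \<union> Q)" "J \<subseteq> lead i (min \<gamma> \<delta>) (P \<union> Q)"
      unfolding IJ by (rule lead_mono; simp)+
    ultimately show "\<exists>H\<in>\<J>. I \<subseteq> H \<and> J \<subseteq> H" by blast
  qed (rule that)
  then obtain \<gamma> P where P: "lfin P" "P \<subseteq> {0..}" "I = lead i \<gamma> P" unfolding \<J>_def by blast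
  have "lead i \<gamma>' P' \<subseteq> lead i \<gamma> P" if "lfin P'" "P' \<subseteq> {0..}" for \<gamma>' P'
    using I(2) that unfolding P(3) \<J>_def by blast
  then show ?thesis using P(1,2) by blast
qed

text \<open>Multiplying by \<open>T\<^sup>-\<^sup>h\<close> with \<open>h = s + t i\<close> moves a leading term of shifted exponent \<open>s\<close> to the
  normalised place; this is where it matters that \<open>G\<close> is closed under negation.\<close>

lemma coeff_in_lead:
  assumes y: "y \<in> vecs m" and i: "i < n" and s: "vsupp n t (act y) \<subseteq> {s..}"
    and low: "\<And>j. j < i \<Longrightarrow> act y j (s + t j) = \<zero>" and G: "s + t i \<in> G"
  shows "\<exists>\<gamma> P. lfin P \<and> P \<subseteq> {0..} \<and> act y i (s + t i) \<in> lead i \<gamma> P"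
proof -
  define h where "h = - (s + t i)"
  have h: "h \<in> G" unfolding h_def using G by (rule G_minus)
  define z where "z = vscale \<one> h y"
  have z: "z \<in> vecs m" unfolding z_def using y h by (intro vscale_closed) auto
  have act_z: "act z j g = act y j (g - h)" if "j < n" for j g
    using act_scale[OF y one_closed h that] vecs_coeff_closed[OF act_closed[OF y] that]
    by (simp add: z_def)
  define P where "P = (\<lambda>r. r + t i) ` vsupp n t (act z)"
  obtain \<gamma> where \<gamma>: "vsupp m (\<lambda>j. 0) z \<subseteq> {\<gamma>..}"
    using lfin_lower_bound[OF lfin_vsupp[OF z]] by blast
  show ?thesis
  proof (intro exI[of _ \<gamma>] exI[of _ P] conjI)
    show "lfin P"
      unfolding P_def using act_closed[OF z] by (intro lfin_shift lfin_vsupp)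
    have "vsupp n t (act z) \<subseteq> (\<lambda>r. r + h) ` vsupp n t (act y)"
      unfolding z_def by (rule vsupp_act_scale[OF y one_closed h])
    then show "P \<subseteq> {0..}" using s unfolding P_def h_def by force
    show "act y i (s + t i) \<in> lead i \<gamma> P"
    proof (rule leadI[OF z \<gamma>])
      show "act z j (t j - t i) = \<zero>" if "j < i" for j
      proof -
        have "act z j (t j - t i) = act y j (t j - t i - h)" using that i by (intro act_z) simp
        also have "t j - t i - h = s + t j" by (simp add: h_def)
        finally show ?thesis using low[OF that] by simp
      qed
      show "act z i 0 = act y i (s + t i)" using act_z[OF i] by (simp add: h_def add.commute)
    qed (simp add: P_def)
  qed
qed

text \<open>The part of shifted exponent \<open>s\<close> has one coefficient in each position. They are removed in order
  of position: the correction for position \<open>k\<close> comes from \<open>lead k\<close>, so it does not disturb the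
  positions before \<open>k\<close>, and what it does after \<open>k\<close> is repaired later. Each correction stays
  within \<open>s + P\<close> for one common \<open>P\<close>.\<close>

lemma leading_part_cancellable:
  "\<exists>\<gamma> P. lfin P \<and> P \<subseteq> {0..} \<and>
    (\<forall>y\<in>vecs m. \<forall>s. vsupp n t (act y) \<subseteq> {s..} \<longrightarrow>
      (\<exists>z\<in>vecs m. vsupp m (\<lambda>j. 0) z \<subseteq> {s + \<gamma>..} \<and> vsupp n t (act z) \<subseteq> (\<lambda>p. s + p) ` P \<and>
        vsupp n t (act (vsub y z)) \<subseteq> {s<..}))"
proof -
  have "\<forall>i. \<exists>\<gamma> P. i < n \<longrightarrow> lfin P \<and> P \<subseteq> {0..} \<and>
    (\<forall>\<gamma>' P'. lfin P' \<longrightarrow> P' \<subseteq> {0..} \<longrightarrow> lead i \<gamma>' P' \<subseteq> lead i \<gamma> P)"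
    using lead_stabilises by blast
  then obtain \<gamma> P where P: "\<And>i. i < n \<Longrightarrow> lfin (P i)" "\<And>i. i < n \<Longrightarrow> P i \<subseteq> {0..}"
    and max: "\<And>i \<gamma>' P'. i < n \<Longrightarrow> lfin P' \<Longrightarrow> P' \<subseteq> {0..} \<Longrightarrow> lead i \<gamma>' P' \<subseteq> lead i (\<gamma> i) (P i)"
    by metis
  define U where "U = (\<Union>i\<in>{..<n}. P i)"
  have U: "lfin U" "U \<subseteq> {0..}" unfolding U_def using P by (auto intro!: lfin_UN)
  \<comment> \<open>Moving from the normalised place to shifted exponent \<open>s\<close> multiplies by \<open>T\<close> to the power
    \<open>s + t i\<close>, which raises the bound \<open>\<gamma> i\<close> by that amount.\<close>
  have "lfin ((\<lambda>i. t i + \<gamma> i) ` {..<n})" by (simp add: lfin_def)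
  then obtain \<delta> where "(\<lambda>i. t i + \<gamma> i) ` {..<n} \<subseteq> {\<delta>..}" using lfin_lower_bound by blast
  then have \<delta>: "\<delta> \<le> t i + \<gamma> i" if "i < n" for i using that by auto
  have "\<exists>z\<in>vecs m. vsupp m (\<lambda>j. 0) z \<subseteq> {s + \<delta>..} \<and> vsupp n t (act z) \<subseteq> (\<lambda>p. s + p) ` U \<and>
      (\<forall>j<k. act (vsub y z) j (s + t j) = \<zero>)"
    if y: "y \<in> vecs m" and s: "vsupp n t (act y) \<subseteq> {s..}" and "k \<le> n" for y s k
    using that(3)
  proof (induction k)
    case 0
    have "vsupp n t (act (\<lambda>j g. \<zero>)) = {}" by (simp add: vsupp_def act_zero)
    moreover have "vsupp m (\<lambda>j. 0) (\<lambda>j g. \<zero>) = {}" by (simp add: vsupp_def)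
    ultimately show ?case using vzero_closed[of m] by (intro bexI[of _ "\<lambda>j g. \<zero>"]) auto
  next
    case (Suc k)
    then have k: "k < n" by simp
    from Suc obtain z where z: "z \<in> vecs m" "vsupp m (\<lambda>j. 0) z \<subseteq> {s + \<delta>..}"
      "vsupp n t (act z) \<subseteq> (\<lambda>p. s + p) ` U"
      and z0: "\<And>j. j < k \<Longrightarrow> act (vsub y z) j (s + t j) = \<zero>"
      by auto
    define u where "u = vsub y z"
    have u: "u \<in> vecs m" unfolding u_def using y z(1) by (rule vsub_closed)
    have act_u: "act u j g = act y j g \<ominus> act z j g" if "j < n" for j g
      unfolding u_def using y z(1) that by (rule act_sub)
    have "vsupp n t (act u) = vsupp n t (vsub (act y) (act z))"
      by (intro vsupp_cong) (simp add: act_u vsub_def)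
    also have "\<dots> \<subseteq> {s..}"
      using vsupp_vsub[of n t "act y" "act z"] s z(3) U(2) by force
    finally have supp_u: "vsupp n t (act u) \<subseteq> {s..}" .
    show ?case
    proof (cases "s + t k \<in> G")
      case False
      \<comment> \<open>No exponent outside \<open>G\<close> occurs, so there is nothing to cancel in this position.\<close>
      then have "act u k (s + t k) = \<zero>"
        using act_closed[OF u] k by (auto simp: vecs_def N_carrier_iff)
      then show ?thesis using z z0 unfolding u_def by (auto simp: less_Suc_eq)
    next
      case True
      obtain \<gamma>' P' where "lfin P'" "P' \<subseteq> {0..}" "act u k (s + t k) \<in> lead k \<gamma>' P'"
        using coeff_in_lead[OF u k supp_u _ True] z0[folded u_def] by blast
      then have "act u k (s + t k) \<in> lead k (\<gamma> k) (P k)" using max[OF k] by blast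
      then obtain v where v: "v \<in> vecs m" "vsupp m (\<lambda>j. 0) v \<subseteq> {\<gamma> k..}"
        "\<forall>r\<in>vsupp n t (act v). r + t k \<in> P k"
        "\<forall>j<k. act v j (t j - t k) = \<zero>" "act v k 0 = act u k (s + t k)"
        by (rule leadE)
      define v' where "v' = vscale \<one> (s + t k) v"
      have v': "v' \<in> vecs m" unfolding v'_def using v(1) True by (intro vscale_closed) auto
      have act_v': "act v' j g = act v j (g - (s + t k))" if "j < n" for j g
        using act_scale[OF v(1) one_closed True that] vecs_coeff_closed[OF act_closed[OF v(1)] that]
        by (simp add: v'_def)
      show ?thesis
      proof (intro bexI[of _ "vadd z v'"] conjI allI impI)
        show "vadd z v' \<in> vecs m" using z(1) v' by (rule vadd_closed)
        have "vsupp m (\<lambda>j. 0) v' \<subseteq> (\<lambda>r. r + (s + t k)) ` vsupp m (\<lambda>j. 0) v"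
          unfolding v'_def by (rule vsupp_vscale) simp
        also have "\<dots> \<subseteq> {s + \<delta>..}" using v(2) \<delta>[OF k] by force
        finally show "vsupp m (\<lambda>j. 0) (vadd z v') \<subseteq> {s + \<delta>..}"
          using vsupp_vadd[of m "\<lambda>j. 0" z v'] z(2) by blast
        have "vsupp n t (act v') \<subseteq> (\<lambda>r. r + (s + t k)) ` vsupp n t (act v)"
          unfolding v'_def by (rule vsupp_act_scale[OF v(1) one_closed True])
        also have "\<dots> \<subseteq> (\<lambda>p. s + p) ` U"
        proof (rule image_subsetI)
          fix r assume "r \<in> vsupp n t (act v)"
          then have "r + t k \<in> U" using v(3) k by (auto simp: U_def)
          then show "r + (s + t k) \<in> (\<lambda>p. s + p) ` U"
            by (intro image_eqI[of _ _ "r + t k"]) auto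
        qed
        finally show "vsupp n t (act (vadd z v')) \<subseteq> (\<lambda>p. s + p) ` U"
          using vsupp_act_add[OF z(1) v'] z(3) by blast
      next
        fix j assume j: "j < Suc k"
        then have jn: "j < n" using k by simp
        have cl: "act x j g \<in> carrier K" if "x \<in> vecs m" for x g
          using act_closed[OF that] jn by (rule vecs_coeff_closed)
        have "act (vsub y (vadd z v')) j (s + t j)
            = act y j (s + t j) \<ominus> (act z j (s + t j) \<oplus> act v' j (s + t j))"
          using act_sub[OF y vadd_closed[OF z(1) v'] jn] act_add[OF z(1) v' jn] by simp
        also have "\<dots> = act u j (s + t j) \<ominus> act v' j (s + t j)"
          using act_u[OF jn] cl[OF y] cl[OF z(1)] cl[OF v']
          by (simp add: a_minus_def minus_add a_assoc)
        also have "act v' j (s + t j) = act u j (s + t j)"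
        proof (cases "j = k")
          case True
          then show ?thesis using act_v'[OF jn] v(5) by simp
        next
          case False
          then have "j < k" using j by simp
          then show ?thesis using act_v'[OF jn, of "s + t j"] v(4) z0 by (simp add: u_def)
        qed
        also have "act u j (s + t j) \<ominus> act u j (s + t j) = \<zero>"
          using cl[OF u] by (simp add: a_minus_def r_neg)
        finally show "act (vsub y (vadd z v')) j (s + t j) = \<zero>" .
      qed
    qed
  qed
  from this[OF _ _ order_refl] have full:
    "\<exists>z\<in>vecs m. vsupp m (\<lambda>j. 0) z \<subseteq> {s + \<delta>..} \<and> vsupp n t (act z) \<subseteq> (\<lambda>p. s + p) ` U \<and>
      (\<forall>j<n. act (vsub y z) j (s + t j) = \<zero>)"
    if "y \<in> vecs m" "vsupp n t (act y) \<subseteq> {s..}" for y s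
    using that by blast
  show ?thesis
  proof (intro exI[of _ \<delta>] exI[of _ U] conjI ballI allI impI)
    show "lfin U" "U \<subseteq> {0..}" by (rule U)+
    fix y s assume y: "y \<in> vecs m" and s: "vsupp n t (act y) \<subseteq> {s..}"
    from full[OF this] obtain z where z: "z \<in> vecs m" "vsupp m (\<lambda>j. 0) z \<subseteq> {s + \<delta>..}"
      "vsupp n t (act z) \<subseteq> (\<lambda>p. s + p) ` U"
      and z0: "\<And>j. j < n \<Longrightarrow> act (vsub y z) j (s + t j) = \<zero>"
      by blast
    have "vsupp n t (act (vsub y z)) = vsupp n t (vsub (act y) (act z))"
      using act_sub[OF y z(1)] by (intro vsupp_cong) (simp add: vsub_def[of "act y"])
    also have "\<dots> \<subseteq> {s..}"
      using vsupp_vsub[of n t "act y" "act z"] s z(3) U(2) by force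
    finally have "vsupp n t (act (vsub y z)) \<subseteq> {s..}" .
    moreover have "s \<notin> vsupp n t (act (vsub y z))" using z0 by (simp add: vsupp_def)
    ultimately have "vsupp n t (act (vsub y z)) \<subseteq> {s<..}" by (force simp: less_le)
    then show "\<exists>z\<in>vecs m. vsupp m (\<lambda>j. 0) z \<subseteq> {s + \<delta>..} \<and>
        vsupp n t (act z) \<subseteq> (\<lambda>p. s + p) ` U \<and> vsupp n t (act (vsub y z)) \<subseteq> {s<..}"
      using z by blast
  qed
qed

section \<open>Existence of an optimal approximation\<close>

text \<open>Comparison of the shifted valuations of two residuals, phrased through supports: an exact
  solution has empty residual support, so nothing is better than it.\<close>

definition better where
  "better w y x \<longleftrightarrow> (\<exists>s\<in>vsupp n t (vsub w (act x)).
    vsupp n t (vsub w (act x)) \<subseteq> {s..} \<and> vsupp n t (vsub w (act y)) \<subseteq> {s<..})"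

lemma vsub_act_closed: "w \<in> vecs n \<Longrightarrow> x \<in> vecs m \<Longrightarrow> vsub w (act x) \<in> vecs n"
  by (intro vsub_closed act_closed)

text \<open>If every approximation within the bound could be improved, repeated cancellation of leading
  parts would converge to an exact solution within the bound, which cannot be improved.\<close>

lemma optimal_approximation_exists:
  "\<exists>\<gamma>. \<forall>w\<in>vecs n. \<forall>s\<^sub>0\<in>vsupp n t w. vsupp n t w \<subseteq> {s\<^sub>0..} \<longrightarrow>
    (\<exists>x\<in>vecs m. vsupp m (\<lambda>j. 0) x \<subseteq> {s\<^sub>0 + \<gamma>..} \<and> \<not> (\<exists>y\<in>vecs m. better w y x))"
proof -
  obtain \<gamma> P where P: "lfin P" "P \<subseteq> {0..}" and cancel:
    "\<forall>y\<in>vecs m. \<forall>s. vsupp n t (act y) \<subseteq> {s..} \<longrightarrow>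
      (\<exists>z\<in>vecs m. vsupp m (\<lambda>j. 0) z \<subseteq> {s + \<gamma>..} \<and> vsupp n t (act z) \<subseteq> (\<lambda>p. s + p) ` P \<and>
        vsupp n t (act (vsub y z)) \<subseteq> {s<..})"
    using leading_part_cancellable by blast
  show ?thesis
  proof (intro exI[of _ \<gamma>] ballI impI, rule ccontr)
    fix w s\<^sub>0
    assume w: "w \<in> vecs n" and s\<^sub>0: "s\<^sub>0 \<in> vsupp n t w" "vsupp n t w \<subseteq> {s\<^sub>0..}"
      and "\<not> (\<exists>x\<in>vecs m. vsupp m (\<lambda>j. 0) x \<subseteq> {s\<^sub>0 + \<gamma>..} \<and> \<not> (\<exists>y\<in>vecs m. better w y x))"
    then have no_opt: "\<exists>y\<in>vecs m. better w y x"
      if "x \<in> vecs m" "vsupp m (\<lambda>j. 0) x \<subseteq> {s\<^sub>0 + \<gamma>..}" for x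
      using that by blast
    define r where "r x = vsupp n t (vsub w (act x))" for x
    define E where "E = translates (vsupp n t w) P"
    have E: "lfin E" unfolding E_def using lfin_vsupp[OF w] P by (rule lfin_translates)
    have E_ge: "s\<^sub>0 \<le> e" if "e \<in> E" for e
      using that s\<^sub>0(2) P(2) unfolding E_def by (rule translates_lower_bound)
    have w_coeff: "w i g \<in> carrier K" if "i < n" for i g
      using w that by (rule vecs_coeff_closed)
    have act_coeff: "act x i g \<in> carrier K" if "x \<in> vecs m" "i < n" for x i g
      using act_closed[OF that(1)] that(2) by (rule vecs_coeff_closed)
    \<comment> \<open>A stage of the division: an approximation with the valuation of its residual. Confining the
      support of the residual to \<open>E\<close> forces these valuations to tend to infinity.\<close>
    define stage where "stage x s \<longleftrightarrow> x \<in> vecs m \<and> vsupp m (\<lambda>j. 0) x \<subseteq> {s\<^sub>0 + \<gamma>..} \<and>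
      r x \<subseteq> E \<and> r x \<subseteq> {s..} \<and> s \<in> r x" for x s
    have "\<exists>f. \<forall>k. case_prod stage (f k) \<and>
      (snd (f k) < snd (f (Suc k)) \<and>
        (\<forall>j<m. \<forall>g<snd (f k) + \<gamma>. fst (f (Suc k)) j g = fst (f k) j g))"
    proof (rule dependent_nat_choice[where P = "\<lambda>k. case_prod stage"])
      have "r (\<lambda>j g. \<zero>) = vsupp n t w"
        unfolding r_def by (intro vsupp_cong) (simp add: vsub_def act_zero w_coeff a_minus_def)
      moreover have "vsupp n t w \<subseteq> E" unfolding E_def using translates.base by blast
      moreover have "vsupp m (\<lambda>j. 0) (\<lambda>j g. \<zero>) = {}" by (simp add: vsupp_def)
      ultimately have "stage (\<lambda>j g. \<zero>) s\<^sub>0"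
        using s\<^sub>0 vzero_closed[of m] by (simp add: stage_def)
      then show "\<exists>xs. case_prod stage xs" by auto
    next
      fix xs and k :: nat
      assume "case_prod stage xs"
      then obtain x s where xs: "xs = (x, s)" and x: "x \<in> vecs m"
        and nu_x: "vsupp m (\<lambda>j. 0) x \<subseteq> {s\<^sub>0 + \<gamma>..}"
        and rx: "r x \<subseteq> E" "r x \<subseteq> {s..}" "s \<in> r x"
        by (auto simp: stage_def)
      have s: "s \<in> E" "s\<^sub>0 \<le> s" using rx E_ge by auto
      obtain y s' where y: "y \<in> vecs m" and "s' \<in> r x" "r x \<subseteq> {s'..}" "r y \<subseteq> {s'<..}"
        using no_opt[OF x nu_x] by (auto simp: better_def r_def)
      then have ry: "r y \<subseteq> {s<..}" using rx by force
      \<comment> \<open>The image of \<open>y - x\<close> is the difference of the two residuals, so it has the same part of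
        exponent \<open>s\<close> as the residual of \<open>x\<close>. The better approximation \<open>y\<close> itself is not taken as
        the next stage, as neither its valuation nor the support of its residual is controlled.\<close>
      define u where "u = vsub y x"
      have u: "u \<in> vecs m" unfolding u_def using y x by (rule vsub_closed)
      have "vsupp n t (act u) = vsupp n t (vsub (vsub w (act x)) (vsub w (act y)))"
      proof (rule vsupp_cong)
        fix i g assume i: "i < n"
        show "act u i g = vsub (vsub w (act x)) (vsub w (act y)) i g"
          unfolding u_def vsub_apply act_sub[OF y x i]
          using w_coeff[OF i] act_coeff[OF x i] act_coeff[OF y i] by (simp add: diff_diff_cancel)
      qed
      also have "\<dots> \<subseteq> r x \<union> r y" unfolding r_def by (rule vsupp_vsub)
      also have "\<dots> \<subseteq> {s..}" using rx ry by force
      finally have "vsupp n t (act u) \<subseteq> {s..}" .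
      from cancel[rule_format, OF u this] obtain z where z: "z \<in> vecs m" "vsupp m (\<lambda>j. 0) z \<subseteq> {s + \<gamma>..}"
        "vsupp n t (act z) \<subseteq> (\<lambda>p. s + p) ` P" "vsupp n t (act (vsub u z)) \<subseteq> {s<..}"
        by blast
      define x' where "x' = vadd x z"
      have x': "x' \<in> vecs m" unfolding x'_def using x z(1) by (rule vadd_closed)
      have nu_x': "vsupp m (\<lambda>j. 0) x' \<subseteq> {s\<^sub>0 + \<gamma>..}"
        using vsupp_vadd[of m "\<lambda>j. 0" x z] nu_x z(2) s(2) unfolding x'_def by force
      have "r x' = vsupp n t (vsub (vsub w (act x)) (act z))"
        unfolding r_def
      proof (rule vsupp_cong)
        fix i g assume i: "i < n"
        show "vsub w (act x') i g = vsub (vsub w (act x)) (act z) i g"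
          unfolding x'_def vsub_apply act_add[OF x z(1) i]
          using w_coeff[OF i] act_coeff[OF x i] act_coeff[OF z(1) i] by (simp add: diff_add)
      qed
      also have "\<dots> \<subseteq> r x \<union> vsupp n t (act z)" unfolding r_def by (rule vsupp_vsub)
      also have "\<dots> \<subseteq> E"
        using rx(1) z(3) translates.step[of s "vsupp n t w" P] s(1) unfolding E_def by blast
      finally have rx'_E: "r x' \<subseteq> E" .
      have "r x' = vsupp n t (vadd (vsub w (act y)) (act (vsub u z)))"
        unfolding r_def
      proof (rule vsupp_cong)
        fix i g assume i: "i < n"
        show "vsub w (act x') i g = vadd (vsub w (act y)) (act (vsub u z)) i g"
          unfolding x'_def vsub_apply vadd_apply act_add[OF x z(1) i] act_sub[OF u z(1) i]
          unfolding u_def act_sub[OF y x i]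
          using w_coeff[OF i] act_coeff[OF x i] act_coeff[OF y i] act_coeff[OF z(1) i]
          by (intro diff_add_telescope)
      qed
      also have "\<dots> \<subseteq> r y \<union> vsupp n t (act (vsub u z))" unfolding r_def by (rule vsupp_vadd)
      also have "\<dots> \<subseteq> {s<..}" using ry z(4) by blast
      finally have rx'_s: "r x' \<subseteq> {s<..}" .
      \<comment> \<open>An empty residual support means an exact solution, which nothing improves.\<close>
      have "r x' \<noteq> {}"
      proof
        assume "r x' = {}"
        moreover obtain v where "v \<in> vecs m" "better w v x'" using no_opt[OF x' nu_x'] by blast
        ultimately show False by (auto simp: better_def r_def)
      qed
      then obtain s' where s': "s' \<in> r x'" "r x' \<subseteq> {s'..}"
        using lfin_min[of "r x'"] lfin_vsupp[OF vsub_act_closed[OF w x']] unfolding r_def by blast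
      have "stage x' s'" using x' nu_x' rx'_E s' by (simp add: stage_def)
      moreover have "s < s'" using rx'_s s' by blast
      moreover have "x' j g = x j g" if "j < m" "g < s + \<gamma>" for j g
      proof -
        have "z j g = \<zero>" using z(2) that by (intro vsupp_coeff_zero[of j m g "\<lambda>j. 0"]) auto
        then show ?thesis using vecs_coeff_closed[OF x that(1)] by (simp add: x'_def vadd_def)
      qed
      ultimately show "\<exists>xs'. case_prod stage xs' \<and> (snd xs < snd xs' \<and>
          (\<forall>j<m. \<forall>g<snd xs + \<gamma>. fst xs' j g = fst xs j g))"
        by (intro exI[of _ "(x', s')"]) (simp add: xs)
    qed
    then obtain f where "\<forall>k. case_prod stage (f k) \<and>
      (snd (f k) < snd (f (Suc k)) \<and>
        (\<forall>j<m. \<forall>g<snd (f k) + \<gamma>. fst (f (Suc k)) j g = fst (f k) j g))" ..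
    then have f: "\<And>k. case_prod stage (f k)" "\<And>k. snd (f k) < snd (f (Suc k))"
      "\<And>k j g. j < m \<Longrightarrow> g < snd (f k) + \<gamma> \<Longrightarrow> fst (f (Suc k)) j g = fst (f k) j g"
      by simp_all
    define x where "x k = fst (f k)" for k
    define s where "s k = snd (f k)" for k
    have x: "x k \<in> vecs m" "vsupp m (\<lambda>j. 0) (x k) \<subseteq> {s\<^sub>0 + \<gamma>..}"
      and rx: "r (x k) \<subseteq> {s k..}" and sE: "s k \<in> E" for k
      using f(1)[of k] by (auto simp: stage_def x_def s_def split: prod.splits)
    have mono: "strict_mono s" unfolding s_def using f(2) by (simp add: strict_mono_Suc_iff)
    have x_stable: "x l j g = x k j g" if "k \<le> l" "j < m" "g < s k + \<gamma>" for k l j g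
      using that(1)
    proof (induction l rule: dec_induct)
      case (step l)
      have "s k \<le> s l" using mono step.hyps(1) by (simp add: strict_mono_less_eq)
      then show ?case using f(3)[of j g l] that step.IH by (simp add: x_def s_def)
    qed simp
    have unbounded: "\<exists>k. C \<le> s k" for C
      using strict_mono_in_lfin_unbounded[OF E mono sE] by blast
    \<comment> \<open>The coefficients at \<open>g\<close> are constant from stage \<open>idx g\<close> on, so the limit can be read off
      there.\<close>
    define idx where "idx g = (LEAST k. g < s k + \<gamma>)" for g
    define x_lim where "x_lim j g = x (idx g) j g" for j g
    have x_lim_eq: "x_lim j g = x k j g" if "j < m" "g < s k + \<gamma>" for j g k
    proof -
      have "idx g \<le> k" unfolding idx_def using that(2) by (rule Least_le)
      moreover have "g < s (idx g) + \<gamma>" unfolding idx_def using that(2) by (rule LeastI)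
      ultimately show ?thesis unfolding x_lim_def using x_stable that(1) by metis
    qed
    have approx: "\<exists>k. C < s k + \<gamma>" for C
    proof -
      obtain k where "C - \<gamma> + 1 \<le> s k" using unbounded by blast
      then show ?thesis by (intro exI[of _ k]) simp
    qed
    have x_lim: "x_lim \<in> vecs m"
      unfolding vecs_def N_carrier_iff
    proof (intro CollectI allI impI conjI)
      fix j assume j: "j < m"
      have xj: "x k j \<in> carrier N" for k using x(1) j by (simp add: vecs_def)
      show "x_lim j g \<in> carrier K" for g using N_coeff_closed[OF xj] by (simp add: x_lim_def)
      show "x_lim j g = \<zero>" if "g \<notin> G" for g using xj that by (simp add: x_lim_def N_carrier_iff)
      show "lfin {g. x_lim j g \<noteq> \<zero>}"
        unfolding lfin_def
      proof
        fix C
        obtain k where k: "C < s k + \<gamma>" using approx by blast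
        have "x_lim j g = x k j g" if "g < C" for g using x_lim_eq[OF j, of g k] k that by simp
        then have "{g. x_lim j g \<noteq> \<zero>} \<inter> {..<C} \<subseteq> {g. x k j g \<noteq> \<zero>} \<inter> {..<C}"
          by auto
        then show "finite ({g. x_lim j g \<noteq> \<zero>} \<inter> {..<C})"
          using xj[of k] finite_subset unfolding N_carrier_iff lfin_def by blast
      qed
    qed
    have nu_x_lim: "vsupp m (\<lambda>j. 0) x_lim \<subseteq> {s\<^sub>0 + \<gamma>..}"
    proof
      fix g assume "g \<in> vsupp m (\<lambda>j. 0) x_lim"
      then obtain j where "j < m" "x (idx g) j g \<noteq> \<zero>" by (auto simp: vsupp_def x_lim_def)
      then have "g \<in> vsupp m (\<lambda>j. 0) (x (idx g))" by (auto simp: vsupp_def)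
      then show "g \<in> {s\<^sub>0 + \<gamma>..}" using x(2) by blast
    qed
    obtain \<kappa> where \<kappa>:
      "\<forall>x s. (\<forall>j<m. \<forall>h<s. x j h = \<zero>) \<longrightarrow> (\<forall>i<n. \<forall>g<s + \<kappa>. act x i g = \<zero>)"
      using act_lower_bound by blast
    have "w i g \<ominus> act x_lim i g = \<zero>" if i: "i < n" for i g
    proof -
      \<comment> \<open>A stage so late that neither its residual nor the image of its distance to the limit
        reaches the exponent \<open>g\<close> in position \<open>i\<close>.\<close>
      obtain k where k: "max (g - t i + 1) (g - \<kappa> - \<gamma> + 1) \<le> s k" using unbounded by blast
      have "act (vsub x_lim (x k)) i g = \<zero>"
      proof (rule \<kappa>[rule_format, OF _ i])
        show "vsub x_lim (x k) j h = \<zero>" if "j < m" "h < s k + \<gamma>" for j h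
          using x_lim_eq[OF that] vecs_coeff_closed[OF x(1) that(1)] by (simp add: vsub_def a_minus_def r_neg)
        show "g < s k + \<gamma> + \<kappa>" using k by simp
      qed
      moreover have "vsub w (act (x k)) i g = \<zero>"
        using rx[of k] k unfolding r_def by (intro vsupp_coeff_zero[OF i]) auto
      ultimately show ?thesis
        using act_sub[OF x_lim x(1) i] w_coeff[OF i] act_coeff[OF x_lim i] act_coeff[OF x(1) i]
        by (simp add: vsub_def)
    qed
    then have "r x_lim = {}" by (simp add: r_def vsupp_def vsub_def)
    moreover obtain y where "better w y x_lim" using no_opt[OF x_lim nu_x_lim] by blast
    ultimately show False by (auto simp: better_def r_def)
  qed
qed

end

section \<open>Valuations in terms of supports\<close>

context novikov
begin

lemma nu_eq_INF:
  assumes "a \<in> carrier N"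
  shows "nu K a = (INF g\<in>{g. a g \<noteq> \<zero>}. ereal g)"
proof (cases "{g. a g \<noteq> \<zero>} = {}")
  case True
  then show ?thesis by (simp add: nu_def top_ereal_def)
next
  case False
  have "lfin {g. a g \<noteq> \<zero>}" using assms by (simp add: N_carrier_iff)
  then obtain g where g: "g \<in> {g. a g \<noteq> \<zero>}" "{g. a g \<noteq> \<zero>} \<subseteq> {g..}"
    using False by (rule lfin_min)
  then have "(LEAST g. a g \<noteq> \<zero>) = g" by (intro Least_equality) auto
  moreover have "(INF g\<in>{g. a g \<noteq> \<zero>}. ereal g) = ereal g"
    using g by (intro antisym INF_lower2[OF g(1)] INF_greatest) auto
  ultimately show ?thesis using False by (simp add: nu_def)
qed

lemma le_nu_bar_shift_iff:
  assumes "\<And>i. i < k \<Longrightarrow> x i \<in> carrier N"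
  shows "c \<le> nu_bar_shift K k t x \<longleftrightarrow> (\<forall>r\<in>vsupp k t x. c \<le> ereal r)"
proof -
  have "c \<le> nu K (x i) - ereal (t i) \<longleftrightarrow> (\<forall>r. x i (r + t i) \<noteq> \<zero> \<longrightarrow> c \<le> ereal r)" if "i < k" for i
  proof -
    have "c \<le> nu K (x i) - ereal (t i) \<longleftrightarrow> c + ereal (t i) \<le> nu K (x i)"
      by (rule ereal_le_minus) simp
    also have "\<dots> \<longleftrightarrow> (\<forall>g. x i g \<noteq> \<zero> \<longrightarrow> c + ereal (t i) \<le> ereal g)"
      by (simp add: nu_eq_INF assms that le_INF_iff)
    also have "\<dots> \<longleftrightarrow> (\<forall>r. x i (r + t i) \<noteq> \<zero> \<longrightarrow> c + ereal (t i) \<le> ereal (r + t i))"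
      by (metis diff_add_cancel)
    also have "\<dots> \<longleftrightarrow> (\<forall>r. x i (r + t i) \<noteq> \<zero> \<longrightarrow> c \<le> ereal r)"
      by (cases c) auto
    finally show ?thesis .
  qed
  then show ?thesis by (auto simp: nu_bar_shift_def le_INF_iff vsupp_def)
qed

lemma nu_bar_shift_eq_INF:
  assumes "x \<in> vecs k"
  shows "nu_bar_shift K k t x = (INF r\<in>vsupp k t x. ereal r)"
proof (rule antisym)
  show "nu_bar_shift K k t x \<le> (INF r\<in>vsupp k t x. ereal r)"
    using le_nu_bar_shift_iff[of k x "nu_bar_shift K k t x" t] assms
    by (auto simp: vecs_def intro: INF_greatest)
  show "(INF r\<in>vsupp k t x. ereal r) \<le> nu_bar_shift K k t x"
    using assms by (subst le_nu_bar_shift_iff) (auto simp: vecs_def intro: INF_lower)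
qed

lemma nu_bar_eq_shift: "nu_bar K k x = nu_bar_shift K k (\<lambda>j. 0) x"
  by (simp add: nu_bar_def nu_bar_shift_def flip: zero_ereal_def)

lemma nu_bar_shift_min:
  assumes "x \<in> vecs k" "s \<in> vsupp k t x" "vsupp k t x \<subseteq> {s..}"
  shows "nu_bar_shift K k t x = ereal s"
  unfolding nu_bar_shift_eq_INF[OF assms(1)]
  using assms(2,3) by (intro antisym INF_lower2[OF assms(2)] INF_greatest) auto

lemma nu_bar_shift_less_witness:
  assumes x: "x \<in> vecs k" and y: "y \<in> vecs k" and less: "nu_bar_shift K k t x < nu_bar_shift K k t y"
  obtains s where "s \<in> vsupp k t x" "vsupp k t x \<subseteq> {s..}" "vsupp k t y \<subseteq> {s<..}"
proof -
  have "vsupp k t x \<noteq> {}"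
    using less by (auto simp: nu_bar_shift_eq_INF[OF x] top_ereal_def)
  then obtain s where s: "s \<in> vsupp k t x" "vsupp k t x \<subseteq> {s..}"
    using lfin_vsupp[OF x] lfin_min by blast
  have "s < r" if "r \<in> vsupp k t y" for r
  proof -
    have "ereal s < nu_bar_shift K k t y" using less nu_bar_shift_min[OF x s] by simp
    also have "\<dots> \<le> ereal r" unfolding nu_bar_shift_eq_INF[OF y] using that by (rule INF_lower)
    finally show ?thesis by simp
  qed
  then show ?thesis using that s by auto
qed

end

theorem theorem2p5:
  fixes K :: "('a, 'b) ring_scheme"
    and G :: "real set"
    and n m :: nat
    and A :: "nat \<Rightarrow> nat \<Rightarrow> real \<Rightarrow> 'a"
    and t :: "nat \<Rightarrow> real"
  assumes "cring K"
    and "noetherian_ring K"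
    and "subgroup G real_add_group"
    and "\<And>i j. i < n \<Longrightarrow> j < m \<Longrightarrow> A i j \<in> carrier (novikov_ring K G)"
  shows "\<exists>\<gamma>::real. \<forall>w \<in> novikov_vecs K G n. \<exists>x\<^sub>0 \<in> novikov_vecs K G m.
      nu_bar K m x\<^sub>0 \<ge> nu_bar_shift K n t w - ereal \<gamma> \<and>
      nu_bar_shift K n t (novikov_diff_vec K G n w (novikov_mult_vec K G n m A x\<^sub>0))
        = (SUP x \<in> novikov_vecs K G m.
            nu_bar_shift K n t (novikov_diff_vec K G n w (novikov_mult_vec K G n m A x)))"
proof -
  interpret novikov_matrix K G n m A t
    using assms by (intro novikov_matrix.intro novikov.intro novikov_axioms.intro
        novikov_matrix_axioms.intro)
  obtain \<gamma> where \<gamma>: "\<forall>w\<in>vecs n. \<forall>s\<^sub>0\<in>vsupp n t w. vsupp n t w \<subseteq> {s\<^sub>0..} \<longrightarrow>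
    (\<exists>x\<in>vecs m. vsupp m (\<lambda>j. 0) x \<subseteq> {s\<^sub>0 + \<gamma>..} \<and> \<not> (\<exists>y\<in>vecs m. better w y x))"
    using optimal_approximation_exists by blast
  have in_vecs: "x \<in> vecs k" if "x \<in> novikov_vecs K G k" for x k
    using that by (auto simp: novikov_vecs_def vecs_def)
  show ?thesis
  \<comment> \<open>\<open>\<gamma>\<close> bounds valuations from below relative to \<open>w\<close>, while the constant in the goal is a loss.\<close>
  proof (intro exI[of _ "- \<gamma>"] ballI)
    fix w assume "w \<in> novikov_vecs K G n"
    then have w: "w \<in> vecs n" by (rule in_vecs)
    define dist where
      "dist x = nu_bar_shift K n t (novikov_diff_vec K G n w (novikov_mult_vec K G n m A x))" for x
    have dist: "dist x = nu_bar_shift K n t (vsub w (act x))" if x: "x \<in> vecs m" for x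
      unfolding dist_def nu_bar_shift_def
    proof (rule INF_cong[OF refl])
      fix i assume "i \<in> {..<n}"
      then have i: "i < n" by simp
      have "novikov_diff_vec K G n w (novikov_mult_vec K G n m A x) i = w i \<ominus>\<^bsub>N\<^esub> act x i"
        using i act_eq_finsum[OF x i] by (simp add: novikov_diff_vec_def novikov_mult_vec_def)
      also have "\<dots> = vsub w (act x) i"
        using w act_closed[OF x] i by (auto simp: vecs_def vsub_def N_minus)
      finally show "nu K (novikov_diff_vec K G n w (novikov_mult_vec K G n m A x) i) - ereal (t i)
          = nu K (vsub w (act x) i) - ereal (t i)" by simp
    qed
    obtain x where x: "x \<in> vecs m" "nu_bar_shift K n t w - ereal (- \<gamma>) \<le> nu_bar K m x"
      and opt: "\<not> (\<exists>y\<in>vecs m. better w y x)"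
    proof (cases "vsupp n t w = {}")
      case True
      have "vsupp n t (vsub w (act (\<lambda>j g. \<zero>\<^bsub>K\<^esub>))) = vsupp n t w"
        by (intro vsupp_cong) (simp add: vsub_def act_zero vecs_coeff_closed[OF w] a_minus_def)
      then have "\<not> (\<exists>y\<in>vecs m. better w y (\<lambda>j g. \<zero>\<^bsub>K\<^esub>))" using True by (simp add: better_def)
      moreover have "nu_bar K m (\<lambda>j g. \<zero>\<^bsub>K\<^esub>) = \<infinity>"
        unfolding nu_bar_eq_shift nu_bar_shift_eq_INF[OF vzero_closed]
        by (simp add: vsupp_def top_ereal_def)
      ultimately show ?thesis using that[OF vzero_closed] by simp
    next
      case False
      then obtain s\<^sub>0 where s\<^sub>0: "s\<^sub>0 \<in> vsupp n t w" "vsupp n t w \<subseteq> {s\<^sub>0..}"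
        using lfin_vsupp[OF w] lfin_min by blast
      from \<gamma>[rule_format, OF w this] obtain x where x: "x \<in> vecs m" "vsupp m (\<lambda>j. 0) x \<subseteq> {s\<^sub>0 + \<gamma>..}"
        and opt: "\<not> (\<exists>y\<in>vecs m. better w y x)" by blast
      have "ereal (s\<^sub>0 + \<gamma>) \<le> nu_bar K m x"
        unfolding nu_bar_eq_shift nu_bar_shift_eq_INF[OF x(1)]
        using x(2) by (intro INF_greatest) auto
      then show ?thesis using that[OF x(1) _ opt] nu_bar_shift_min[OF w s\<^sub>0] by simp
    qed
    have le: "dist y \<le> dist x" if y: "y \<in> vecs m" for y
    proof (rule ccontr)
      assume "\<not> dist y \<le> dist x"
      then have "nu_bar_shift K n t (vsub w (act x)) < nu_bar_shift K n t (vsub w (act y))"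
        using dist x(1) y by simp
      then show False
        using opt y nu_bar_shift_less_witness[OF vsub_act_closed[OF w x(1)] vsub_act_closed[OF w y]]
        unfolding better_def by metis
    qed
    \<comment> \<open>Only the entries with index below \<open>m\<close> matter, so \<open>x\<close> can be made extensional.\<close>
    define x\<^sub>0 where "x\<^sub>0 = restrict x {..<m}"
    have x\<^sub>0: "x\<^sub>0 \<in> novikov_vecs K G m"
      using x(1) by (auto simp: x\<^sub>0_def novikov_vecs_def vecs_def)
    have "act x i = act x\<^sub>0 i" if "i < n" for i
      using act_cong[OF _ x(1) that, of x\<^sub>0] by (auto simp: x\<^sub>0_def)
    then have "nu_bar_shift K n t (vsub w (act x)) = nu_bar_shift K n t (vsub w (act x\<^sub>0))"
      unfolding nu_bar_shift_def vsub_def by (intro INF_cong) auto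
    then have eq: "dist x\<^sub>0 = dist x" using dist x(1) in_vecs[OF x\<^sub>0] by simp
    have "dist x\<^sub>0 = (SUP x \<in> novikov_vecs K G m. dist x)"
      using le in_vecs x\<^sub>0 eq by (intro antisym SUP_upper SUP_least) auto
    moreover have "nu_bar K m x\<^sub>0 = nu_bar K m x"
      unfolding nu_bar_def x\<^sub>0_def by (intro INF_cong) auto
    ultimately show "\<exists>x\<^sub>0 \<in> novikov_vecs K G m. nu_bar K m x\<^sub>0 \<ge> nu_bar_shift K n t w - ereal (- \<gamma>) \<and>
      nu_bar_shift K n t (novikov_diff_vec K G n w (novikov_mult_vec K G n m A x\<^sub>0))
        = (SUP x \<in> novikov_vecs K G m.
            nu_bar_shift K n t (novikov_diff_vec K G n w (novikov_mult_vec K G n m A x)))"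
      using x\<^sub>0 x(2) unfolding dist_def by (intro bexI[of _ x\<^sub>0]) auto
  qed
qed

end
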